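(* Suppose $\gamma_0\in\mathcal{M}_2(\mathbb{R})$ has rapidly decaying central affine curvature $q_0$, and let $q(x,t)$ be the (rapidly decaying) solution of the KdV equation $q_t=\frac14(q_{xxx}-6qq_x)$ with initial data $q(x,0)=q_0(x)$. Let $g:\mathbb{R}^2\to SL(2,\mathbb{R})$ denote the solution of the linear system $$g_x=g\begin{pmatrix}0&q\\1&0\end{pmatrix},\qquad g_t=g\begin{pmatrix}\frac14q_x&\frac14(q_{xx}-2q^2)\\-\frac q2&-\frac14q_x\end{pmatrix}$$ with $g(0,0)=(\gamma_0(0),(\gamma_0)_x(0))$ (the $2\times2$ matrix with these columns). Then $\gamma(x,t)=g(x,t)(1,0)^t$ is the solution of the central affine curve flow $$\gamma_t=\tfrac14q_x\gamma-\tfrac12q\gamma_x$$ (where $q(\cdot,t)$ is the central affine curvature of $\gamma(\cdot,t)$) with $\gamma(x,0)=\gamma_0(x)$. Moreover, the central affine curvatures of $\gamma(\cdot,t)$ are also rapidly decaying.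
   Context: $\mathcal{M}_2(\mathbb{R})$ is the set of smooth curves $\gamma:\mathbb{R}\to\mathbb{R}^2\setminus\{0\}$ (column vectors) with $\det(\gamma,\gamma_x)=1$. For such a curve there is a unique smooth function $q$ with $\gamma_{xx}=q\gamma$, called the central affine curvature of $\gamma$. A solution of the curve flow on $\mathcal{M}_2(\mathbb{R})$ is a smooth map $\gamma(x,t)$ with $\gamma(\cdot,t)\in\mathcal{M}_2(\mathbb{R})$ for all $t$ satisfying the stated evolution equation, $q(\cdot,t)$ being the central affine curvature of $\gamma(\cdot,t)$. "Rapidly decaying" means in the Schwartz class $\mathcal{S}(\mathbb{R},\mathbb{R})$. It is known that the Cauchy problem for the KdV equation with initial data in $\mathcal{S}(\mathbb{R},\mathbb{R})$ has a unique smooth global solution which is rapidly decaying in $x$ (locally uniformly in $t$); "the solution" of KdV refers to this one. Correspondingly "the solution" of the curve flow is understood in the class of solutions whose central affine curvature is rapidly decaying in $x$ (locally uniformly in $t$). *)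

theory Defs
  imports "HOL-Analysis.Analysis"
begin

text \<open>
  \<open>C_k k f\<close>: \<open>f\<close> is of class \<open>C\<^sup>k\<close> on the whole (finite-dimensional) space.  It is used both for
  functions of \<open>x\<close> and, with domain \<^typ>\<open>real \<times> real\<close>, for joint smoothness in \<open>(x, t)\<close>.
\<close>

primrec C_k :: "nat \<Rightarrow> ('a::euclidean_space \<Rightarrow> 'b::real_normed_vector) \<Rightarrow> bool" where
  "C_k 0 f \<longleftrightarrow> continuous_on UNIV f"
| "C_k (Suc k) f \<longleftrightarrow>
     (\<forall>z. f differentiable (at z)) \<and> (\<forall>v. C_k k (\<lambda>z. frechet_derivative f (at z) v))"

definition smooth :: "('a::euclidean_space \<Rightarrow> 'b::real_normed_vector) \<Rightarrow> bool" where
  "smooth f \<longleftrightarrow> (\<forall>k. C_k k f)"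

definition D :: "(real \<Rightarrow> 'a::real_normed_vector) \<Rightarrow> real \<Rightarrow> 'a" where
  "D f x = vector_derivative f (at x)"

definition Dx :: "(real \<times> real \<Rightarrow> 'a::real_normed_vector) \<Rightarrow> real \<times> real \<Rightarrow> 'a" where
  "Dx f = (\<lambda>(x, t). D (\<lambda>y. f (y, t)) x)"

definition Dt :: "(real \<times> real \<Rightarrow> 'a::real_normed_vector) \<Rightarrow> real \<times> real \<Rightarrow> 'a" where
  "Dt f = (\<lambda>(x, t). D (\<lambda>s. f (x, s)) t)"

definition schwartz :: "(real \<Rightarrow> real) \<Rightarrow> bool" where
  "schwartz f \<longleftrightarrow> smooth f \<and> (\<forall>m n. \<exists>C. \<forall>x. \<bar>x ^ m * (D ^^ n) f x\<bar> \<le> C)"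

text \<open>Schwartz seminorms in \<open>x\<close>, bounded locally uniformly in \<open>t\<close>.\<close>

definition rapidly_decaying_loc_unif :: "(real \<times> real \<Rightarrow> real) \<Rightarrow> bool" where
  "rapidly_decaying_loc_unif q \<longleftrightarrow>
     (\<forall>K. compact K \<longrightarrow> (\<forall>m n. \<exists>C. \<forall>x. \<forall>t\<in>K. \<bar>x ^ m * (Dx ^^ n) q (x, t)\<bar> \<le> C))"

definition mat_of_cols :: "real ^ 2 \<Rightarrow> real ^ 2 \<Rightarrow> real ^ 2 ^ 2" where
  "mat_of_cols u v = transpose (vector [u, v])"

definition mat_of_entries :: "real \<Rightarrow> real \<Rightarrow> real \<Rightarrow> real \<Rightarrow> real ^ 2 ^ 2" where
  "mat_of_entries a b c d = vector [vector [a, b], vector [c, d]]"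

definition M2 :: "(real \<Rightarrow> real ^ 2) set" where
  "M2 = {\<gamma>. smooth \<gamma> \<and> (\<forall>x. \<gamma> x \<noteq> 0) \<and> (\<forall>x. det (mat_of_cols (\<gamma> x) (D \<gamma> x)) = 1)}"

definition central_affine_curvature :: "(real \<Rightarrow> real ^ 2) \<Rightarrow> real \<Rightarrow> real" where
  "central_affine_curvature \<gamma> = (THE q. smooth q \<and> (\<forall>x. D (D \<gamma>) x = q x *\<^sub>R \<gamma> x))"

definition flow_curvature :: "(real \<times> real \<Rightarrow> real ^ 2) \<Rightarrow> real \<times> real \<Rightarrow> real" where
  "flow_curvature \<gamma> = (\<lambda>(x, t). central_affine_curvature (\<lambda>y. \<gamma> (y, t)) x)"

definition kdv_solution :: "(real \<times> real \<Rightarrow> real) \<Rightarrow> bool" where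
  "kdv_solution q \<longleftrightarrow> smooth q \<and>
     (\<forall>z. Dt q z = 1/4 * (Dx (Dx (Dx q)) z - 6 * q z * Dx q z))"

definition curve_flow_solution :: "(real \<times> real \<Rightarrow> real ^ 2) \<Rightarrow> bool" where
  "curve_flow_solution \<gamma> \<longleftrightarrow> smooth \<gamma> \<and> (\<forall>t. (\<lambda>x. \<gamma> (x, t)) \<in> M2) \<and>
     (let q = flow_curvature \<gamma> in
      \<forall>z. Dt \<gamma> z = (1/4 * Dx q z) *\<^sub>R \<gamma> z - (1/2 * q z) *\<^sub>R Dx \<gamma> z)"

text \<open>
  The class in which the Cauchy problem for the curve flow is posed; ``the solution'' with initial
  curve \<open>\<gamma>\<^sub>0\<close> means the unique element of this class.
\<close>

definition curve_flow_cauchy ::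
    "(real \<Rightarrow> real ^ 2) \<Rightarrow> (real \<times> real \<Rightarrow> real ^ 2) \<Rightarrow> bool" where
  "curve_flow_cauchy \<gamma>\<^sub>0 \<gamma> \<longleftrightarrow> curve_flow_solution \<gamma> \<and>
     rapidly_decaying_loc_unif (flow_curvature \<gamma>) \<and> (\<forall>x. \<gamma> (x, 0) = \<gamma>\<^sub>0 x)"

definition frame_solution ::
    "(real \<times> real \<Rightarrow> real) \<Rightarrow> (real \<Rightarrow> real ^ 2) \<Rightarrow> (real \<times> real \<Rightarrow> real ^ 2 ^ 2) \<Rightarrow> bool" where
  "frame_solution q \<gamma>\<^sub>0 g \<longleftrightarrow> smooth g \<and> (\<forall>z. det (g z) = 1) \<and>
     (\<forall>z. Dx g z = g z ** mat_of_entries 0 (q z) 1 0) \<and>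
     (\<forall>z. Dt g z = g z ** mat_of_entries
        (1/4 * Dx q z) (1/4 * (Dx (Dx q) z - 2 * (q z)\<^sup>2))
        (- (q z / 2)) (- (1/4 * Dx q z))) \<and>
     g (0, 0) = mat_of_cols (\<gamma>\<^sub>0 0) (D \<gamma>\<^sub>0 0)"

end

theory Submission
  imports Defs
begin

text \<open>
  Why the theorem holds.  In terms of the frame \<open>g = (\<gamma>, \<gamma>\<^sub>x)\<close> the two equations \<open>\<gamma>\<^sub>x\<^sub>x = q \<gamma>\<close> and
  \<open>\<gamma>\<^sub>t = q\<^sub>x/4 \<gamma> - q/2 \<gamma>\<^sub>x\<close> become a linear system \<open>g\<^sub>x = g A\<close>, \<open>g\<^sub>t = g B\<close> whose coefficients depend
  on \<open>q\<close> only, and the KdV equation is exactly the compatibility condition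
  \<open>A\<^sub>t + B A = B\<^sub>x + A B\<close> of this system (\<open>kdv_zero_curvature\<close>).  So for a KdV solution \<open>q\<close> the system
  has precisely one solution with a prescribed value at the origin; its determinant is constant since
  \<open>A\<close> and \<open>B\<close> have trace zero, and its first column is a curve with curvature \<open>q(\<cdot>, t)\<close> that moves
  by the flow.  At \<open>t = 0\<close> the frame solves the same linear equation in \<open>x\<close> as the frame of
  \<open>\<gamma>\<^sub>0\<close>, which gives the initial condition.

  Conversely, let \<open>\<beta>\<close> be any solution of the curve flow, with curvature \<open>p\<close>.  Commuting \<open>\<partial>\<^sub>t\<close> with
  \<open>\<partial>\<^sub>x\<^sup>2\<close> on \<open>\<beta>\<close> yields the KdV equation for \<open>p\<close>, and the frame of \<open>\<beta>\<close> solves the linear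
  system belonging to \<open>p\<close> (\<open>curve_flow_frame\<close>).  If \<open>\<beta>\<close> starts at \<open>\<gamma>\<^sub>0\<close> and \<open>p\<close> decays rapidly, then
  \<open>p\<close> and \<open>q\<close> have the same initial values, so \<open>p = q\<close> by uniqueness for rapidly decaying KdV solutions (\<open>kdv_unique\<close>, an
  energy estimate for \<open>p - q\<close>), and then both frames agree by uniqueness for the linear system.

  The analytic core is the existence of a smooth parallel section of a flat connection on the plane
  (\<open>flat_connection_parallel_section\<close>).  The system is solved first along the axis \<open>x = 0\<close> and then
  in the \<open>x\<close>-direction with \<open>t\<close> as a parameter, by Picard iteration.  That the resulting function \<open>h\<close>
  also satisfies \<open>h\<^sub>t = h B\<close> is shown without differentiating an ordinary differential equation with
  respect to its parameter: one compares \<open>h\<close> with \<open>k(x,t) = h(x,0) + \<integral>\<^sub>0\<^sup>t h B ds\<close>, for which flatness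
  gives a homogeneous linear integro-differential equation for \<open>k - h\<close>, and a Gronwall argument shows
  \<open>k = h\<close>.
\<close>

section \<open>Calculus of smooth functions\<close>

text \<open>
  The recursive clause of \<open>C_k\<close> speaks of the Frechet derivative; this form lets any explicit formula
  for the derivative be used instead, and drives the inductions below.
\<close>

lemma C_k_SucI:
  assumes "\<And>z. (f has_derivative f' z) (at z)" and "\<And>v. C_k k (\<lambda>z. f' z v)"
  shows "C_k (Suc k) f"
proof -
  have "frechet_derivative f (at z) = f' z" for z
    using frechet_derivative_at[OF assms(1)] by simp
  with assms(2) have "\<forall>v. C_k k (\<lambda>z. frechet_derivative f (at z) v)" by simp
  moreover have "\<forall>z. f differentiable (at z)" using assms(1) differentiable_def by blast
  ultimately show ?thesis by simp
qed

lemma C_k_has_derivative: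
  "C_k (Suc k) f \<Longrightarrow> (f has_derivative frechet_derivative f (at z)) (at z)"
  by (simp add: frechet_derivative_works)

lemma C_k_frechet: "C_k (Suc k) f \<Longrightarrow> C_k k (\<lambda>z. frechet_derivative f (at z) v)"
  by simp

lemma C_k_SucD: "C_k (Suc k) f \<Longrightarrow> C_k k f"
proof (induction k arbitrary: f)
  case 0
  then show ?case
    by (auto intro!: continuous_at_imp_continuous_on differentiable_imp_continuous_within)
next
  case (Suc k)
  show ?case
    by (rule C_k_SucI[OF C_k_has_derivative[OF Suc.prems] Suc.IH[OF C_k_frechet[OF Suc.prems]]])
qed

lemma C_k_const: "C_k k (\<lambda>z. c)"
proof (induction k arbitrary: c)
  case (Suc k)
  show ?case by (rule C_k_SucI[where f'="\<lambda>_ _. 0"]) (auto intro: Suc)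
qed simp

lemma C_k_add: "C_k k f \<Longrightarrow> C_k k g \<Longrightarrow> C_k k (\<lambda>z. f z + g z)"
proof (induction k arbitrary: f g)
  case 0
  then show ?case using continuous_on_add[of UNIV f g] by simp
next
  case (Suc k)
  show ?case
  proof (rule C_k_SucI)
    show "((\<lambda>z. f z + g z) has_derivative
        (\<lambda>v. frechet_derivative f (at z) v + frechet_derivative g (at z) v)) (at z)" for z
      by (intro has_derivative_add Suc.prems[THEN C_k_has_derivative])
    show "C_k k (\<lambda>z. frechet_derivative f (at z) v + frechet_derivative g (at z) v)" for v
      by (intro Suc.IH C_k_frechet Suc.prems)
  qed
qed

lemma C_k_linear:
  assumes L: "bounded_linear L"
  shows "C_k k f \<Longrightarrow> C_k k (\<lambda>z. L (f z))"
proof (induction k arbitrary: f)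
  case 0
  then show ?case using bounded_linear.continuous_on[OF L, of UNIV f] by simp
next
  case (Suc k)
  show ?case
  proof (rule C_k_SucI)
    show "((\<lambda>z. L (f z)) has_derivative (\<lambda>v. L (frechet_derivative f (at z) v))) (at z)" for z
      by (rule bounded_linear.has_derivative[OF L C_k_has_derivative[OF Suc.prems]])
    show "C_k k (\<lambda>z. L (frechet_derivative f (at z) v))" for v
      by (intro Suc.IH C_k_frechet Suc.prems)
  qed
qed

lemma C_k_bilinear:
  assumes P: "bounded_bilinear P"
  shows "C_k k f \<Longrightarrow> C_k k g \<Longrightarrow> C_k k (\<lambda>z. P (f z) (g z))"
proof (induction k arbitrary: f g)
  case 0
  then show ?case using bounded_bilinear.continuous_on[OF P, of UNIV f g] by simp
next
  case (Suc k)
  show ?case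
  proof (rule C_k_SucI)
    show "((\<lambda>z. P (f z) (g z)) has_derivative
        (\<lambda>v. P (f z) (frechet_derivative g (at z) v) + P (frechet_derivative f (at z) v) (g z))) (at z)" for z
      by (rule bounded_bilinear.FDERIV[OF P Suc.prems[THEN C_k_has_derivative]])
    show "C_k k (\<lambda>z. P (f z) (frechet_derivative g (at z) v) + P (frechet_derivative f (at z) v) (g z))" for v
      by (rule C_k_add[OF Suc.IH[OF C_k_SucD[OF Suc.prems(1)] C_k_frechet[OF Suc.prems(2)]]
            Suc.IH[OF C_k_frechet[OF Suc.prems(1)] C_k_SucD[OF Suc.prems(2)]]])
  qed
qed

lemma C_k_affine:
  assumes L: "bounded_linear L"
  shows "C_k k f \<Longrightarrow> C_k k (\<lambda>z. f (c + L z))"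
proof (induction k arbitrary: f)
  case 0
  have "continuous_on UNIV (\<lambda>z. c + L z)"
    using bounded_linear.continuous_on[OF L continuous_on_id, of UNIV]
    by (intro continuous_on_add continuous_on_const)
  with 0 show ?case
    using continuous_on_compose2[of UNIV f UNIV "\<lambda>z. c + L z"] by simp
next
  case (Suc k)
  have a: "((\<lambda>z. c + L z) has_derivative L) (at z)" for z
    using has_derivative_add[OF has_derivative_const[of c] bounded_linear_imp_has_derivative[OF L]]
    by simp
  show ?case
  proof (rule C_k_SucI)
    show "((\<lambda>z. f (c + L z)) has_derivative (\<lambda>v. frechet_derivative f (at (c + L z)) (L v))) (at z)" for z
      by (rule has_derivative_compose[OF a]) (rule C_k_has_derivative[OF Suc.prems])
    show "C_k k (\<lambda>z. frechet_derivative f (at (c + L z)) (L v))" for v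
      by (rule Suc.IH[OF C_k_frechet[OF Suc.prems]])
  qed
qed

lemma smooth_const: "smooth (\<lambda>z. c)"
  by (simp add: smooth_def C_k_const)

lemma smooth_add:
  assumes "smooth f" "smooth g"
  shows "smooth (\<lambda>z. f z + g z)"
  unfolding smooth_def using assms[unfolded smooth_def] by (intro allI C_k_add) simp_all

lemma smooth_linear:
  assumes "bounded_linear L" "smooth f"
  shows "smooth (\<lambda>z. L (f z))"
  unfolding smooth_def
  by (intro allI C_k_linear[OF assms(1)] assms(2)[unfolded smooth_def, rule_format])

lemma smooth_bilinear:
  assumes "bounded_bilinear P" "smooth f" "smooth g"
  shows "smooth (\<lambda>z. P (f z) (g z))"
  unfolding smooth_def
  by (intro allI C_k_bilinear[OF assms(1)] assms(2,3)[unfolded smooth_def, rule_format])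

lemmas smooth_mult = smooth_bilinear[OF bounded_bilinear_mult]
lemmas smooth_scaleR = smooth_bilinear[OF bounded_bilinear_scaleR]

lemma smooth_minus: "smooth f \<Longrightarrow> smooth (\<lambda>z. - f z)"
  using smooth_linear[OF bounded_linear_minus[OF bounded_linear_ident]] .

lemma smooth_diff: "smooth f \<Longrightarrow> smooth g \<Longrightarrow> smooth (\<lambda>z. f z - g z)"
  using smooth_add[of f, OF _ smooth_minus[of g]] by simp

lemma smooth_nth: "smooth f \<Longrightarrow> smooth (\<lambda>z. f z $ i)"
  by (rule smooth_linear[OF bounded_linear_vec_nth])

lemma smooth_has_derivative:
  "smooth f \<Longrightarrow> (f has_derivative frechet_derivative f (at z)) (at z)"
  unfolding smooth_def by (rule C_k_has_derivative) blast

lemma smooth_continuous: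
  assumes "smooth f"
  shows "continuous_on S f"
proof -
  have "C_k 0 f" using assms unfolding smooth_def by blast
  then show ?thesis using continuous_on_subset[of UNIV f S] by simp
qed

lemma smooth_frechet: "smooth f \<Longrightarrow> smooth (\<lambda>z. frechet_derivative f (at z) v)"
  unfolding smooth_def by (intro allI C_k_frechet) blast

lemma smooth_D:
  assumes "smooth f"
  shows "(f has_vector_derivative D f x) (at x)" and "smooth (D f)"
proof -
  have d: "(f has_vector_derivative frechet_derivative f (at x) 1) (at x)" for x
  proof -
    note f = smooth_has_derivative[OF assms, of x]
    have "frechet_derivative f (at x) h = h *\<^sub>R frechet_derivative f (at x) 1" for h
      using linear_cmul[OF has_derivative_linear[OF f], of h 1] by simp
    then have "frechet_derivative f (at x) = (\<lambda>h. h *\<^sub>R frechet_derivative f (at x) 1)" by blast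
    with f show ?thesis unfolding has_vector_derivative_def by metis
  qed
  then have "D f = (\<lambda>x. frechet_derivative f (at x) 1)"
    by (auto simp: D_def vector_derivative_at)
  with d smooth_frechet[OF assms, of 1]
  show "(f has_vector_derivative D f x) (at x)" "smooth (D f)" by simp_all
qed

lemma D_eqI: "(f has_vector_derivative f') (at x) \<Longrightarrow> D f x = f'"
  by (simp add: D_def vector_derivative_at)

lemma smooth_affine:
  assumes "bounded_linear L" "smooth f"
  shows "smooth (\<lambda>z. f (c + L z))"
  unfolding smooth_def
  by (intro allI C_k_affine[OF assms(1)] assms(2)[unfolded smooth_def, rule_format])

lemma smooth_slice_x: "smooth f \<Longrightarrow> smooth (\<lambda>x::real. f (x, t::real))"
  using smooth_affine[OF bounded_linear_Pair[OF bounded_linear_ident bounded_linear_zero], of f "(0, t)"]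
  by simp

lemma smooth_slice_t: "smooth f \<Longrightarrow> smooth (\<lambda>t::real. f (x::real, t))"
  using smooth_affine[OF bounded_linear_Pair[OF bounded_linear_zero bounded_linear_ident], of f "(x, 0)"]
  by simp

lemma Dx_eqI: "((\<lambda>y. f (y, t)) has_vector_derivative f') (at x) \<Longrightarrow> Dx f (x, t) = f'"
  by (simp add: Dx_def D_eqI)

lemma Dt_eqI: "((\<lambda>s. f (x, s)) has_vector_derivative f') (at t) \<Longrightarrow> Dt f (x, t) = f'"
  by (simp add: Dt_def D_eqI)

lemma smooth_Dx_has: "smooth f \<Longrightarrow> ((\<lambda>y. f (y, t)) has_vector_derivative Dx f (x, t)) (at x)"
  using smooth_D(1)[OF smooth_slice_x] by (simp add: Dx_def)

lemma smooth_Dt_has: "smooth f \<Longrightarrow> ((\<lambda>s. f (x, s)) has_vector_derivative Dt f (x, t)) (at t)"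
  using smooth_D(1)[OF smooth_slice_t] by (simp add: Dt_def)

lemma has_derivative_slices:
  fixes f :: "real \<times> real \<Rightarrow> 'a::real_normed_vector"
  assumes f: "(f has_derivative f') (at (x, t))"
  shows "((\<lambda>y. f (y, t)) has_vector_derivative f' (1, 0)) (at x)"
    and "((\<lambda>s. f (x, s)) has_vector_derivative f' (0, 1)) (at t)"
proof -
  have l: "linear f'" using f has_derivative_linear by blast
  have dx: "((\<lambda>y. f (y, t)) has_derivative (\<lambda>v. f' (v, 0))) (at x)"
    by (rule has_derivative_compose[where f="\<lambda>y. (y, t)" and g=f])
      (rule has_derivative_Pair[OF has_derivative_ident has_derivative_const], rule f)
  have dt: "((\<lambda>s. f (x, s)) has_derivative (\<lambda>v. f' (0, v))) (at t)"
    by (rule has_derivative_compose[where f="\<lambda>s. (x, s)" and g=f])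
      (rule has_derivative_Pair[OF has_derivative_const has_derivative_ident], rule f)
  have ex: "(\<lambda>v. f' (v, 0)) = (\<lambda>v. v *\<^sub>R f' (1, 0))"
    and et: "(\<lambda>v. f' (0, v)) = (\<lambda>v. v *\<^sub>R f' (0, 1))"
    using linear_cmul[OF l, of _ "(1,0)"] linear_cmul[OF l, of _ "(0,1)"]
    by (simp_all add: fun_eq_iff flip: linear_cmul[OF l])
  show "((\<lambda>y. f (y, t)) has_vector_derivative f' (1, 0)) (at x)"
    using dx unfolding has_vector_derivative_def ex .
  show "((\<lambda>s. f (x, s)) has_vector_derivative f' (0, 1)) (at t)"
    using dt unfolding has_vector_derivative_def et .
qed

text \<open>
  Partial derivatives of a smooth function are values of its total derivative in the coordinate
  directions, hence smooth again.
\<close>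

lemma smooth_Dx: assumes "smooth f" shows "smooth (Dx f)"
proof -
  have "Dx f = (\<lambda>z. frechet_derivative f (at z) (1, 0))"
  proof (intro ext, clarify)
    fix x t
    show "Dx f (x, t) = frechet_derivative f (at (x, t)) (1, 0)"
      by (rule Dx_eqI[OF has_derivative_slices(1)[OF smooth_has_derivative[OF assms]]])
  qed
  then show ?thesis using smooth_frechet[OF assms] by simp
qed

lemma smooth_Dt: assumes "smooth f" shows "smooth (Dt f)"
proof -
  have "Dt f = (\<lambda>z. frechet_derivative f (at z) (0, 1))"
  proof (intro ext, clarify)
    fix x t
    show "Dt f (x, t) = frechet_derivative f (at (x, t)) (0, 1)"
      by (rule Dt_eqI[OF has_derivative_slices(2)[OF smooth_has_derivative[OF assms]]])
  qed
  then show ?thesis using smooth_frechet[OF assms] by simp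
qed

text \<open>
  A solution of a linear system is known only through its two partial derivatives; this makes it
  differentiable as a function of both variables.
\<close>

lemma has_derivative_from_partials:
  fixes f :: "real \<times> real \<Rightarrow> 'a::real_normed_vector"
  assumes fx: "\<And>x t. ((\<lambda>y. f (y, t)) has_vector_derivative fx (x, t)) (at x)"
    and ft: "\<And>x t. ((\<lambda>s. f (x, s)) has_vector_derivative ft (x, t)) (at t)"
    and cont: "continuous_on UNIV ft"
  shows "(f has_derivative (\<lambda>(a, b). a *\<^sub>R fx z + b *\<^sub>R ft z)) (at z)"
proof -
  obtain x t where z: "z = (x, t)" by (cases z)
  have c: "continuous_on UNIV (\<lambda>z. blinfun_scaleR_left (ft z))"
    by (intro continuous_intros cont bounded_linear.continuous_on[OF bounded_linear_blinfun_scaleR_left])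
  have "((\<lambda>(x, y). f (x, y)) has_derivative
      (\<lambda>(a, b). a *\<^sub>R fx (x, t) + blinfun_scaleR_left (ft (x, t)) b)) (at (x, t) within UNIV \<times> UNIV)"
    by (rule has_derivative_partialsI[where fy="\<lambda>x t. blinfun_scaleR_left (ft (x, t))"])
      (use fx ft c in \<open>auto simp: has_vector_derivative_def continuous_on_eq_continuous_at split_def\<close>)
  then show ?thesis by (simp add: z)
qed

section \<open>Primitives depending on a parameter\<close>

text \<open>
  The primitive of \<open>f\<close> vanishing at \<open>0\<close>, that is \<open>\<integral>\<^sub>0\<^sup>x f\<close>.  After rescaling to the unit interval the
  formula is correct for both signs of \<open>x\<close>, and the domain of integration no longer depends on \<open>x\<close>, so
  that joint continuity in \<open>x\<close> and a parameter follows from the theorems on parameter integrals.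
\<close>

definition prim :: "(real \<Rightarrow> 'v::euclidean_space) \<Rightarrow> real \<Rightarrow> 'v" where
  "prim f x = x *\<^sub>R integral {0..1} (\<lambda>s. f (s * x))"

lemma prim_0 [simp]: "prim f 0 = 0"
  by (simp add: prim_def)

lemma continuous_on_scaled_arg:
  assumes "continuous_on UNIV (f :: real \<Rightarrow> 'v::euclidean_space)"
  shows "continuous_on S (\<lambda>s. f (s * x))"
  by (rule continuous_on_compose2[OF assms]) (auto intro!: continuous_intros)

lemma prim_eq_diff_local:
  assumes f: "continuous_on UNIV f" and x: "\<bar>x\<bar> \<le> R"
    and F: "\<And>y. y \<in> {-R..R} \<Longrightarrow> (F has_vector_derivative f y) (at y within {-R..R})"
  shows "prim f x = F x - F 0"
proof -
  have sub: "s * x \<in> {-R..R}" if "s \<in> {0..1}" for s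
  proof -
    have "\<bar>s * x\<bar> \<le> 1 * \<bar>x\<bar>" unfolding abs_mult using that by (intro mult_right_mono) auto
    with x show ?thesis by (auto simp: abs_le_iff)
  qed
  have "((\<lambda>s. x *\<^sub>R f (s * x)) has_integral (F \<circ> (\<lambda>s. s * x)) 1 - (F \<circ> (\<lambda>s. s * x)) 0) {0..1}"
  proof (rule fundamental_theorem_of_calculus)
    fix s :: real assume s: "s \<in> {0..1}"
    have "((\<lambda>s. s * x) has_vector_derivative x) (at s within {0..1})"
      by (auto intro!: derivative_eq_intros)
    moreover have "(F has_vector_derivative f (s * x)) (at (s * x) within (\<lambda>s. s * x) ` {0..1})"
      by (rule has_vector_derivative_within_subset[OF F[OF sub[OF s]]]) (use sub in auto)
    ultimately show "(F \<circ> (\<lambda>s. s * x) has_vector_derivative x *\<^sub>R f (s * x)) (at s within {0..1})"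
      by (rule vector_diff_chain_within)
  qed simp
  from integral_unique[OF this] show ?thesis by (simp add: prim_def)
qed

lemma prim_has_vector_derivative:
  assumes f: "continuous_on UNIV f"
  shows "(prim f has_vector_derivative f x) (at x)"
proof -
  \<comment> \<open>one unit of room keeps x in the interior of the interval\<close>
  define R where "R = \<bar>x\<bar> + 1"
  have "continuous_on {-R..R} f" using f continuous_on_subset by blast
  then obtain F where F: "\<And>y. y \<in> {-R..R} \<Longrightarrow> (F has_vector_derivative f y) (at y within {-R..R})"
    using antiderivative_continuous by blast
  have x: "x \<in> {-R<..<R}" unfolding R_def by auto
  have "(F has_vector_derivative f x) (at x)"
    using F[of x] x by (auto simp: at_within_Icc_at)
  then have "((\<lambda>y. F y - F 0) has_vector_derivative f x) (at x)"
    by (auto intro!: derivative_eq_intros)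
  then show ?thesis
    by (rule has_vector_derivative_transform_within_open[where S="{-R<..<R}"])
      (use x prim_eq_diff_local[OF f _ F] in auto)
qed

lemma prim_eq_diff:
  assumes "continuous_on UNIV f" and "\<And>y. (F has_vector_derivative f y) (at y)"
  shows "prim f x = F x - F 0"
  by (rule prim_eq_diff_local[OF assms(1) order_refl])
    (rule has_vector_derivative_at_within[OF assms(2)])

lemma continuous_on_slice_x:
  "continuous_on UNIV f \<Longrightarrow> continuous_on S (\<lambda>y. f (y, p))"
  by (erule continuous_on_compose2) (auto intro!: continuous_intros)

lemma continuous_on_slice_t:
  "continuous_on UNIV f \<Longrightarrow> continuous_on S (\<lambda>p. f (y, p))"
  by (erule continuous_on_compose2) (auto intro!: continuous_intros)

lemma prim_continuous:
  fixes f :: "real \<times> real \<Rightarrow> 'v::euclidean_space"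
  assumes f: "continuous_on UNIV f"
  shows "continuous_on UNIV (\<lambda>z. prim (\<lambda>y. f (y, snd z)) (fst z))"
proof -
  have "continuous_on (UNIV \<times> cbox 0 1) (\<lambda>w. f (snd w * fst (fst w), snd (fst w)))"
    by (rule continuous_on_compose2[OF f]) (auto intro!: continuous_intros)
  then have "continuous_on (UNIV \<times> cbox 0 1) (\<lambda>(z, s). f (s * fst z, snd z))"
    by (simp add: split_def)
  then have "continuous_on UNIV (\<lambda>z. integral (cbox 0 1) (\<lambda>s::real. f (s * fst z, snd z)))"
    by (rule integral_continuous_on_param)
  then show ?thesis unfolding prim_def by (auto intro!: continuous_intros)
qed

lemma prim_param_derivative:
  fixes f :: "real \<times> real \<Rightarrow> 'v::euclidean_space"
  assumes f: "continuous_on UNIV f" and f': "continuous_on UNIV f'"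
    and d: "\<And>y p. ((\<lambda>p. f (y, p)) has_vector_derivative f' (y, p)) (at p)"
  shows "((\<lambda>p. prim (\<lambda>y. f (y, p)) x) has_vector_derivative prim (\<lambda>y. f' (y, p)) x) (at p)"
proof -
  have "((\<lambda>p. integral (cbox 0 1) (\<lambda>s. f (s * x, p))) has_vector_derivative
      integral (cbox 0 1) (\<lambda>s. f' (s * x, p))) (at p within UNIV)"
  proof (rule leibniz_rule_vector_derivative)
    show "(\<lambda>s. f (s * x, p)) integrable_on cbox 0 1" for p
      by (intro integrable_continuous continuous_on_scaled_arg continuous_on_slice_x f)
    have "continuous_on (UNIV \<times> cbox 0 1) (\<lambda>w. f' (snd w * x, fst w))"
      by (rule continuous_on_compose2[OF f']) (auto intro!: continuous_intros)
    then show "continuous_on (UNIV \<times> cbox 0 1) (\<lambda>(p, s). f' (s * x, p))"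
      by (simp add: split_def)
  qed (use d in auto)
  then show ?thesis
    unfolding prim_def by (auto intro!: derivative_eq_intros)
qed

text \<open>
  Write \<open>f(x,t) = f(x,0) + \<integral>\<^sub>0\<^sup>t f\<^sub>t(x,s) ds\<close>, differentiate in \<open>x\<close> under the integral sign, and then
  differentiate in \<open>t\<close> by the fundamental theorem of calculus.
\<close>

lemma mixed_partials_commute:
  fixes f :: "real \<times> real \<Rightarrow> 'v::euclidean_space"
  assumes f: "smooth f"
  shows "Dt (Dx f) = Dx (Dt f)"
proof (intro ext, clarify)
  fix x t
  let ?F = "Dt f"
  have F: "smooth ?F" "smooth (Dx ?F)" "smooth (Dx f)"
    using f smooth_Dt smooth_Dx by blast+
  have sw: "continuous_on UNIV (\<lambda>z. g (snd z, fst z))"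
    if "continuous_on UNIV g" for g :: "real \<times> real \<Rightarrow> 'v"
    by (rule continuous_on_compose2[OF that]) (auto intro!: continuous_intros)
  have fr: "f (y, s) = f (y, 0) + prim (\<lambda>s. ?F (y, s)) s" for y s
    using prim_eq_diff[OF continuous_on_slice_t[OF smooth_continuous[OF F(1)]] smooth_Dt_has[OF f], of y s]
    by simp
  have "((\<lambda>y. prim (\<lambda>s. ?F (y, s)) t) has_vector_derivative prim (\<lambda>s. Dx ?F (x, s)) t) (at x)" for x t
    using prim_param_derivative[of "\<lambda>z. ?F (snd z, fst z)" "\<lambda>z. Dx ?F (snd z, fst z)" t x]
      sw smooth_continuous F smooth_Dx_has[OF F(1)] by auto
  then have "((\<lambda>y. f (y, 0) + prim (\<lambda>s. ?F (y, s)) t) has_vector_derivative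
      Dx f (x, 0) + prim (\<lambda>s. Dx ?F (x, s)) t) (at x)" for x t
    by (rule has_vector_derivative_add[OF smooth_Dx_has[OF f]])
  then have "((\<lambda>y. f (y, t)) has_vector_derivative
      Dx f (x, 0) + prim (\<lambda>s. Dx ?F (x, s)) t) (at x)" for x t
    by (simp flip: fr)
  then have dx: "Dx f (x, s) = Dx f (x, 0) + prim (\<lambda>s. Dx ?F (x, s)) s" for s
    by (rule Dx_eqI)
  have "((\<lambda>s. Dx f (x, 0) + prim (\<lambda>s. Dx ?F (x, s)) s) has_vector_derivative 0 + Dx ?F (x, t)) (at t)"
    by (intro has_vector_derivative_add has_vector_derivative_const prim_has_vector_derivative
        continuous_on_slice_t smooth_continuous F)
  then show "Dt (Dx f) (x, t) = Dx (Dt f) (x, t)"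
    by (intro Dt_eqI) (simp flip: dx)
qed

lemma prim_add:
  assumes "continuous_on UNIV f" "continuous_on UNIV g"
  shows "prim (\<lambda>s. f s + g s) x = prim f x + prim g x"
  unfolding prim_def using assms
  by (subst integral_add)
    (auto intro!: integrable_continuous_real continuous_on_scaled_arg simp: scaleR_add_right)

lemma prim_norm_le_power:
  assumes f: "continuous_on UNIV f" and b: "\<And>y. \<bar>y\<bar> \<le> \<bar>x\<bar> \<Longrightarrow> norm (f y) \<le> c * \<bar>y\<bar> ^ n"
  shows "norm (prim f x) \<le> c * \<bar>x\<bar> ^ Suc n / Suc n"
proof -
  have "((\<lambda>s. c * \<bar>x\<bar> ^ n * s ^ n) has_integral
      c * \<bar>x\<bar> ^ n * (1 ^ Suc n / Suc n) - c * \<bar>x\<bar> ^ n * (0 ^ Suc n / Suc n)) {0..1}"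
  proof (rule fundamental_theorem_of_calculus)
    fix s :: real
    have "((\<lambda>s. c * \<bar>x\<bar> ^ n * (s ^ Suc n / Suc n)) has_real_derivative c * \<bar>x\<bar> ^ n * s ^ n) (at s within {0..1})"
      by (rule derivative_eq_intros refl | simp)+
    then show "((\<lambda>s. c * \<bar>x\<bar> ^ n * (s ^ Suc n / Suc n)) has_vector_derivative c * \<bar>x\<bar> ^ n * s ^ n) (at s within {0..1})"
      by (simp add: has_real_derivative_iff_has_vector_derivative)
  qed simp
  then have I: "((\<lambda>s. c * \<bar>x\<bar> ^ n * s ^ n) has_integral c * \<bar>x\<bar> ^ n / Suc n) {0..1}" by simp
  have "norm (integral {0..1} (\<lambda>s. f (s * x))) \<le> integral {0..1} (\<lambda>s. c * \<bar>x\<bar> ^ n * s ^ n)"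
  proof (rule integral_norm_bound_integral)
    fix s :: real assume s: "s \<in> {0..1}"
    have "\<bar>s * x\<bar> \<le> 1 * \<bar>x\<bar>" unfolding abs_mult using s by (intro mult_right_mono) auto
    with b[of "s * x"] s show "norm (f (s * x)) \<le> c * \<bar>x\<bar> ^ n * s ^ n"
      by (simp add: abs_mult power_mult_distrib mult_ac)
  qed (use I f in \<open>auto intro!: integrable_continuous_real continuous_on_scaled_arg continuous_intros\<close>)
  also have "\<dots> = c * \<bar>x\<bar> ^ n / Suc n" using I by (rule integral_unique)
  finally have "\<bar>x\<bar> * norm (integral {0..1} (\<lambda>s. f (s * x))) \<le> \<bar>x\<bar> * (c * \<bar>x\<bar> ^ n / Suc n)"
    by (rule mult_left_mono) simp
  then show ?thesis by (simp add: prim_def mult_ac)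
qed

lemma prim_norm_le:
  assumes "continuous_on UNIV f" "\<And>y. \<bar>y\<bar> \<le> \<bar>x\<bar> \<Longrightarrow> norm (f y) \<le> c"
  shows "norm (prim f x) \<le> c * \<bar>x\<bar>"
  using prim_norm_le_power[OF assms(1), of x c 0] assms(2) by simp

lemma prim_tendsto:
  assumes f: "\<And>n. continuous_on UNIV (f n)"
    and u: "uniform_limit {-\<bar>x\<bar>..\<bar>x\<bar>} f g sequentially"
  shows "(\<lambda>n. prim (f n) x) \<longlonglongrightarrow> prim g x"
proof -
  have "uniform_limit {0..1} (\<lambda>n s. f n (s * x)) (\<lambda>s. g (s * x)) sequentially"
  proof (rule uniform_limitI)
    fix e :: real assume "e > 0"
    from uniform_limitD[OF u this]
    show "\<forall>\<^sub>F n in sequentially. \<forall>s\<in>{0..1}. dist (f n (s * x)) (g (s * x)) < e"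
    proof eventually_elim
      case (elim n)
      have "s * x \<in> {-\<bar>x\<bar>..\<bar>x\<bar>}" if "s \<in> {0..1}" for s
      proof -
        have "\<bar>s * x\<bar> \<le> 1 * \<bar>x\<bar>" unfolding abs_mult using that by (intro mult_right_mono) auto
        then show ?thesis by (auto simp: abs_le_iff)
      qed
      with elim show ?case by blast
    qed
  qed
  from uniform_limit_integral[OF this continuous_on_scaled_arg[OF f] sequentially_bot]
  obtain I J where IJ: "\<And>n. ((\<lambda>s. f n (s * x)) has_integral I n) {0..1}"
    "((\<lambda>s. g (s * x)) has_integral J) {0..1}" "I \<longlonglongrightarrow> J" by blast
  have "I = (\<lambda>n. integral {0..1} (\<lambda>s. f n (s * x)))" "J = integral {0..1} (\<lambda>s. g (s * x))"
    using IJ(1)[THEN integral_unique] IJ(2)[THEN integral_unique] by auto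
  with IJ(3) show ?thesis unfolding prim_def by (auto intro!: tendsto_intros)
qed

section \<open>Linear equations along one variable\<close>

text \<open>
  The terms of the Neumann series of \<open>h(x,t) = G(t) + \<integral>\<^sub>0\<^sup>x P (h(y,t)) (A(y,t)) dy\<close>, where \<open>P\<close> is the
  bilinear action of the coefficients on the unknown.
\<close>

primrec picard_term ::
  "('v \<Rightarrow> 'a \<Rightarrow> 'v) \<Rightarrow> (real \<times> real \<Rightarrow> 'a) \<Rightarrow> (real \<Rightarrow> 'v) \<Rightarrow> nat \<Rightarrow> real \<times> real \<Rightarrow> 'v::euclidean_space"
where
  "picard_term P A G 0 = (\<lambda>z. G (snd z))"
| "picard_term P A G (Suc n) =
     (\<lambda>z. prim (\<lambda>y. P (picard_term P A G n (y, snd z)) (A (y, snd z))) (fst z))"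

lemma bounded_on_square:
  fixes f :: "real \<times> real \<Rightarrow> 'a::real_normed_vector"
  assumes "continuous_on UNIV f"
  obtains c where "c \<ge> 0" "\<And>x t. \<bar>x\<bar> \<le> R \<Longrightarrow> \<bar>t\<bar> \<le> R \<Longrightarrow> norm (f (x, t)) \<le> c"
proof -
  have "compact (f ` ({-R..R} \<times> {-R..R}))"
    by (intro compact_continuous_image compact_Times compact_Icc continuous_on_subset[OF assms]) simp
  then obtain c where "\<And>z. z \<in> {-R..R} \<times> {-R..R} \<Longrightarrow> norm (f z) \<le> c"
    using compact_imp_bounded bounded_iff by (metis imageI)
  then have "norm (f (x, t)) \<le> max c 0" if "\<bar>x\<bar> \<le> R" "\<bar>t\<bar> \<le> R" for x t
    using that by (auto simp: abs_le_iff le_max_iff_disj)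
  then show thesis using that[of "max c 0"] by simp
qed

text \<open>
  On each square the \<open>n\<close>-th term of the series is at most \<open>M (a k)\<^sup>n \<bar>x\<bar>\<^sup>n / n!\<close>, so the series
  converges locally uniformly on the whole plane.  This gives a global solution that is jointly
  continuous in \<open>x\<close> and the parameter.
\<close>

lemma linear_system_with_parameter:
  fixes P :: "'v::euclidean_space \<Rightarrow> 'a::real_normed_vector \<Rightarrow> 'v"
  assumes P: "bounded_bilinear P"
    and A: "continuous_on UNIV (A :: real \<times> real \<Rightarrow> 'a)" and G: "continuous_on UNIV G"
  obtains h where "continuous_on UNIV h" "\<And>t. h (0, t) = G t"
    "\<And>x t. ((\<lambda>y. h (y, t)) has_vector_derivative P (h (x, t)) (A (x, t))) (at x)"
proof -
  interpret P: bounded_bilinear P by fact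
  let ?T = "picard_term P A G"
  let ?S = "\<lambda>N z. \<Sum>n<N. ?T n z"
  define h where "h = (\<lambda>z. \<Sum>n. ?T n z)"
  obtain k where k: "k > 0" "\<And>a b. norm (P a b) \<le> norm a * norm b * k"
    using P.pos_bounded by blast
  have T: "continuous_on UNIV (?T n)" for n
  proof (induction n)
    case 0
    have "continuous_on UNIV (\<lambda>z. G (snd z))"
      by (rule continuous_on_compose2[OF G]) (auto intro!: continuous_intros)
    then show ?case by simp
  next
    case (Suc n)
    from prim_continuous[OF P.continuous_on[OF Suc A]] show ?case by simp
  qed
  note S = continuous_on_sum[of "{..<_}" UNIV ?T, OF T]
  have Sslice: "continuous_on UNIV (\<lambda>y. P (?S N (y, t)) (A (y, t)))" for N t
    by (rule continuous_on_slice_x[of "\<lambda>z. P (?S N z) (A z)"]) (rule P.continuous_on[OF S A])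
  have Tslice: "continuous_on UNIV (\<lambda>y. P (?T N (y, t)) (A (y, t)))" for N t
    by (rule continuous_on_slice_x[of "\<lambda>z. P (?T N z) (A z)"]) (rule P.continuous_on[OF T A])
  have step: "?S (Suc N) (x, t) = G t + prim (\<lambda>y. P (?S N (y, t)) (A (y, t))) x" for N x t
  proof (induction N)
    case 0
    show ?case by (simp add: P.zero_left prim_def)
  next
    case (Suc N)
    have "?S (Suc (Suc N)) (x, t) = ?S (Suc N) (x, t) + ?T (Suc N) (x, t)" by simp
    also have "\<dots> = G t + prim (\<lambda>y. P (?S N (y, t)) (A (y, t)) + P (?T N (y, t)) (A (y, t))) x"
      by (subst prim_add[OF Sslice Tslice]) (use Suc in simp)
    finally show ?case by (simp add: P.add_left)
  qed
  have lim: "uniform_limit ({-R..R} \<times> {-R..R}) ?S h sequentially" for R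
  proof -
    obtain a where a: "a \<ge> 0" "\<And>x t. \<bar>x\<bar> \<le> R \<Longrightarrow> \<bar>t\<bar> \<le> R \<Longrightarrow> norm (A (x, t)) \<le> a"
      using bounded_on_square[OF A] by blast
    obtain M where M: "M \<ge> 0" "\<And>x t. \<bar>x\<bar> \<le> R \<Longrightarrow> \<bar>t\<bar> \<le> R \<Longrightarrow> norm (?T 0 (x, t)) \<le> M"
      using bounded_on_square[OF T] by metis
    have bd: "norm (?T n (x, t)) \<le> M * (a * k) ^ n / fact n * \<bar>x\<bar> ^ n"
      if "\<bar>x\<bar> \<le> R" "\<bar>t\<bar> \<le> R" for n x t
      using that
    proof (induction n arbitrary: x)
      case 0
      then show ?case using M(2)[of x t] by simp
    next
      case (Suc n)
      have "norm (prim (\<lambda>y. P (?T n (y, t)) (A (y, t))) x)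
          \<le> (M * (a * k) ^ Suc n / fact n) * \<bar>x\<bar> ^ Suc n / Suc n"
      proof (rule prim_norm_le_power[OF Tslice])
        fix y assume y: "\<bar>y\<bar> \<le> \<bar>x\<bar>"
        have "norm (P (?T n (y, t)) (A (y, t))) \<le> norm (?T n (y, t)) * norm (A (y, t)) * k" by (rule k)
        also have "\<dots> \<le> (M * (a * k) ^ n / fact n * \<bar>y\<bar> ^ n) * a * k"
          using Suc.IH[of y] a(2)[of y t] y Suc.prems k(1) a(1) M(1)
          by (intro mult_mono mult_right_mono mult_nonneg_nonneg divide_nonneg_nonneg) auto
        finally show "norm (P (?T n (y, t)) (A (y, t))) \<le> M * (a * k) ^ Suc n / fact n * \<bar>y\<bar> ^ n"
          by (simp add: mult_ac)
      qed
      then show ?case by (simp add: field_simps)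
    qed
    show ?thesis unfolding h_def
    proof (rule Weierstrass_m_test)
      show "norm (?T n z) \<le> M * (inverse (fact n) * (a * k * R) ^ n)" if z: "z \<in> {-R..R} \<times> {-R..R}" for n z
      proof -
        obtain x t where xt: "z = (x, t)" "\<bar>x\<bar> \<le> R" "\<bar>t\<bar> \<le> R" using z by (cases z) (auto simp: abs_le_iff)
        have "norm (?T n z) \<le> M * (a * k) ^ n / fact n * \<bar>x\<bar> ^ n" using bd xt by simp
        also have "\<dots> \<le> M * (a * k) ^ n / fact n * R ^ n"
          using xt a(1) k(1) M(1) by (intro mult_left_mono power_mono) auto
        finally show ?thesis by (simp add: field_simps power_mult_distrib)
      qed
      show "summable (\<lambda>n. M * (inverse (fact n) * (a * k * R) ^ n))"
        by (intro summable_mult summable_exp)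
    qed
  qed
  have h: "continuous_on UNIV h"
  proof (rule continuous_at_imp_continuous_on, clarify)
    fix x t :: real
    \<comment> \<open>one unit of room keeps (x, t) in the interior of the square\<close>
    define R where "R = max \<bar>x\<bar> \<bar>t\<bar> + 1"
    have "continuous_on ({-R..R} \<times> {-R..R}) h"
      by (rule uniform_limit_theorem[OF _ lim])
        (intro always_eventually allI, rule continuous_on_subset[OF S], simp_all)
    then have "continuous_on ({-R<..<R} \<times> {-R<..<R}) h"
      by (rule continuous_on_subset) auto
    moreover have "(x, t) \<in> {-R<..<R} \<times> {-R<..<R}" unfolding R_def by auto
    ultimately show "isCont h (x, t)"
      by (simp add: continuous_on_eq_continuous_at open_Times)
  qed
  have fix_point: "h (x, t) = G t + prim (\<lambda>y. P (h (y, t)) (A (y, t))) x" for x t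
  proof -
    define R where "R = max \<bar>x\<bar> \<bar>t\<bar>"
    have R: "y \<in> {-\<bar>x\<bar>..\<bar>x\<bar>} \<Longrightarrow> (y, t) \<in> {-R..R} \<times> {-R..R}" for y unfolding R_def by auto
    have Sl: "uniform_limit {-\<bar>x\<bar>..\<bar>x\<bar>} (\<lambda>N y. ?S N (y, t)) (\<lambda>y. h (y, t)) sequentially"
    proof (rule uniform_limitI)
      fix e :: real assume "e > 0"
      from uniform_limitD[OF lim[of R] this]
      show "\<forall>\<^sub>F N in sequentially. \<forall>y\<in>{-\<bar>x\<bar>..\<bar>x\<bar>}. dist (?S N (y, t)) (h (y, t)) < e"
        by eventually_elim (use R in blast)
    qed
    have "uniform_limit {-\<bar>x\<bar>..\<bar>x\<bar>} (\<lambda>N y. P (?S N (y, t)) (A (y, t))) (\<lambda>y. P (h (y, t)) (A (y, t))) sequentially"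
      by (rule P.bounded_uniform_limit[OF Sl uniform_limit_const])
        (intro compact_imp_bounded compact_continuous_image compact_Icc continuous_on_slice_x A h)+
    then have "(\<lambda>N. prim (\<lambda>y. P (?S N (y, t)) (A (y, t))) x) \<longlonglongrightarrow> prim (\<lambda>y. P (h (y, t)) (A (y, t))) x"
      by (rule prim_tendsto[OF Sslice])
    then have "(\<lambda>N. ?S (Suc N) (x, t)) \<longlonglongrightarrow> G t + prim (\<lambda>y. P (h (y, t)) (A (y, t))) x"
      unfolding step by (intro tendsto_intros)
    moreover have "(\<lambda>N. ?S (Suc N) (x, t)) \<longlonglongrightarrow> h (x, t)"
    proof -
      have "x \<in> {-\<bar>x\<bar>..\<bar>x\<bar>}" by auto
      from tendsto_uniform_limitI[OF lim R[OF this]] show ?thesis by (rule LIMSEQ_Suc)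
    qed
    ultimately show ?thesis by (rule LIMSEQ_unique[symmetric])
  qed
  show thesis
  proof
    show "continuous_on UNIV h" by fact
    show "h (0, t) = G t" for t using fix_point[of 0 t] by simp
    fix x t
    have "continuous_on UNIV (\<lambda>y. P (h (y, t)) (A (y, t)))"
      by (intro P.continuous_on continuous_on_slice_x h A)
    from has_vector_derivative_add[OF has_vector_derivative_const[of "G t"] prim_has_vector_derivative[OF this]]
    show "((\<lambda>y. h (y, t)) has_vector_derivative P (h (x, t)) (A (x, t))) (at x)"
      by (simp flip: fix_point)
  qed
qed

text \<open>
  A Gronwall lemma in which the derivative at \<open>(x,t)\<close> is controlled by the values \<open>u(x,s)\<close> for all
  parameters \<open>s\<close>.  The weighted norm \<open>\<bar>u(x,t)\<bar> exp(-2kx)\<close> attains its maximum \<open>M\<close> on a rectangle;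
  integrating the resulting bound for \<open>u\<^sub>x\<close> shows \<open>M \<le> M/2\<close>.
\<close>

lemma gronwall_parameter_half:
  fixes u :: "real \<times> real \<Rightarrow> 'v::real_normed_vector"
  assumes u: "continuous_on UNIV u"
    and d: "\<And>x t. ((\<lambda>y. u (y, t)) has_vector_derivative u' (x, t)) (at x)"
    and u0: "\<And>t. \<bar>t\<bar> \<le> T \<Longrightarrow> u (0, t) = 0"
    and K: "\<And>x t m. 0 \<le> x \<Longrightarrow> x \<le> R \<Longrightarrow> \<bar>t\<bar> \<le> T \<Longrightarrow> (\<And>s. \<bar>s\<bar> \<le> T \<Longrightarrow> norm (u (x, s)) \<le> m) \<Longrightarrow> norm (u' (x, t)) \<le> K * m"
    and xt: "0 \<le> x" "x \<le> R" "\<bar>t\<bar> \<le> T"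
  shows "u (x, t) = 0"
proof -
  \<comment> \<open>the maximum with 1 makes the exponent k positive, whatever the sign of K\<close>
  define k where "k = max K 1"
  have k: "k > 0" "K \<le> k" unfolding k_def by auto
  define S where "S = {0..R} \<times> {-T..T}"
  define \<phi> where "\<phi> = (\<lambda>z. norm (u z) * exp (- (2 * k * fst z)))"
  have S: "compact S" "(x, t) \<in> S"
    using xt unfolding S_def by (auto intro!: compact_Times simp: abs_le_iff)
  have "continuous_on S \<phi>"
    unfolding \<phi>_def by (intro continuous_intros continuous_on_subset[OF u]) auto
  then obtain z0 where "z0 \<in> S" and sup: "\<And>z. z \<in> S \<Longrightarrow> \<phi> z \<le> \<phi> z0"
    using continuous_attains_sup[OF S(1)] S(2) by blast
  then obtain x0 t0 where z0: "z0 = (x0, t0)" and x0: "0 \<le> x0" "x0 \<le> R" "\<bar>t0\<bar> \<le> T"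
    unfolding S_def by (cases z0) (auto simp: abs_le_iff)
  define M where "M = \<phi> z0"
  have M: "M \<ge> 0" unfolding M_def \<phi>_def by simp
  have bd: "norm (u (y, s)) \<le> M * exp (2 * k * y)" if "0 \<le> y" "y \<le> R" "\<bar>s\<bar> \<le> T" for y s
  proof -
    have "(y, s) \<in> S" using that by (auto simp: S_def abs_le_iff)
    from sup[OF this] have "norm (u (y, s)) * exp (- (2 * k * y)) \<le> M" unfolding M_def \<phi>_def by simp
    then show ?thesis by (simp add: exp_minus field_simps)
  qed
  have "M \<le> M / 2"
  proof (cases "x0 = 0")
    case True
    then have "M = 0" using u0 x0 unfolding M_def \<phi>_def z0 by simp
    then show ?thesis by simp
  next
    case False
    have "norm (u (x0, t0) - u (0, t0)) \<le> M / 2 * exp (2 * k * x0) - M / 2 * exp (2 * k * 0)"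
    proof (rule differentiable_bound_general)
      show "0 < x0" using x0 False by simp
      show "continuous_on {0..x0} (\<lambda>y. u (y, t0))"
        by (rule continuous_on_slice_x[OF u])
      show "continuous_on {0..x0} (\<lambda>y. M / 2 * exp (2 * k * y))" by (intro continuous_intros)
      fix y assume y: "0 < y" "y < x0"
      show "((\<lambda>y. u (y, t0)) has_vector_derivative u' (y, t0)) (at y)" by (rule d)
      have "((\<lambda>y. M / 2 * exp (2 * k * y)) has_real_derivative k * (M * exp (2 * k * y))) (at y)"
        by (rule derivative_eq_intros refl | simp)+
      then show "((\<lambda>y. M / 2 * exp (2 * k * y)) has_vector_derivative k * (M * exp (2 * k * y))) (at y)"
        by (simp add: has_real_derivative_iff_has_vector_derivative)
      have "norm (u' (y, t0)) \<le> K * (M * exp (2 * k * y))"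
        using y x0 bd by (intro K) auto
      also have "\<dots> \<le> k * (M * exp (2 * k * y))" using M k by (intro mult_right_mono) auto
      finally show "norm (u' (y, t0)) \<le> k * (M * exp (2 * k * y))" .
    qed
    with u0[OF x0(3)] M have "norm (u (x0, t0)) \<le> M / 2 * exp (2 * k * x0)" by simp
    then have "norm (u (x0, t0)) * exp (- (2 * k * x0)) \<le> M / 2"
      by (simp add: exp_minus field_simps)
    then show ?thesis unfolding M_def \<phi>_def z0 by simp
  qed
  with M have "M = 0" by simp
  with bd[OF xt] show ?thesis by simp
qed

lemma gronwall_parameter:
  fixes u :: "real \<times> real \<Rightarrow> 'v::real_normed_vector"
  assumes u: "continuous_on UNIV u"
    and d: "\<And>x t. ((\<lambda>y. u (y, t)) has_vector_derivative u' (x, t)) (at x)"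
    and u0: "\<And>t. \<bar>t\<bar> \<le> T \<Longrightarrow> u (0, t) = 0"
    and K: "\<And>x t m. \<bar>x\<bar> \<le> R \<Longrightarrow> \<bar>t\<bar> \<le> T \<Longrightarrow> (\<And>s. \<bar>s\<bar> \<le> T \<Longrightarrow> norm (u (x, s)) \<le> m) \<Longrightarrow> norm (u' (x, t)) \<le> K * m"
    and xt: "\<bar>x\<bar> \<le> R" "\<bar>t\<bar> \<le> T"
  shows "u (x, t) = 0"
proof (cases "0 \<le> x")
  case True
  show ?thesis
    by (rule gronwall_parameter_half[OF u d u0 K]) (use True xt in auto)
next
  case False
  have c: "continuous_on UNIV (\<lambda>z. u (- fst z, snd z))"
    by (rule continuous_on_compose2[OF u]) (auto intro!: continuous_intros)
  have "(\<lambda>z. u (- fst z, snd z)) (- x, t) = 0"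
  proof (rule gronwall_parameter_half[OF c, where u'="\<lambda>z. - u' (- fst z, snd z)"])
    fix y s
    have "((\<lambda>y. - y) has_vector_derivative -1) (at y)" by (auto intro!: derivative_eq_intros)
    from vector_diff_chain_at[OF this d, of s]
    show "((\<lambda>y. u (- fst (y, s), snd (y, s))) has_vector_derivative - u' (- fst (y, s), snd (y, s))) (at y)"
      by (simp add: o_def)
  next
    fix y s m assume "0 \<le> y" "y \<le> R" "\<bar>s\<bar> \<le> T" and
      "\<And>r. \<bar>r\<bar> \<le> T \<Longrightarrow> norm (u (- fst (y, r), snd (y, r))) \<le> m"
    then show "norm (- u' (- fst (y, s), snd (y, s))) \<le> K * m"
      using K[of "-y" s m] by simp
  qed (use u0 False xt in auto)
  then show ?thesis by simp
qed

lemma gronwall_ode: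
  fixes u :: "real \<Rightarrow> 'v::real_normed_vector"
  assumes d: "\<And>x. (u has_vector_derivative u' x) (at x)" and u0: "u 0 = 0"
    and c: "continuous_on UNIV c" and K: "\<And>x. norm (u' x) \<le> c x * norm (u x)"
  shows "u x = 0"
proof -
  define R where "R = \<bar>x\<bar>"
  have "continuous_on UNIV (\<lambda>z::real \<times> real. c (fst z))"
    by (rule continuous_on_compose2[OF c]) (auto intro!: continuous_intros)
  then obtain k where k: "k \<ge> 0" "\<And>x t. \<bar>x\<bar> \<le> R \<Longrightarrow> \<bar>t\<bar> \<le> R \<Longrightarrow> norm (c (fst (x, t))) \<le> k"
    using bounded_on_square[of "\<lambda>z. c (fst z)"] by blast
  have "continuous_on UNIV u"
    using d has_vector_derivative_continuous by (blast intro: continuous_at_imp_continuous_on)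
  then have cu: "continuous_on UNIV (\<lambda>z::real \<times> real. u (fst z))"
    by (rule continuous_on_compose2) (auto intro!: continuous_intros)
  have "(\<lambda>z. u (fst z)) (x, 0::real) = 0"
  proof (rule gronwall_parameter[OF cu, where T=0 and R=R and u'="\<lambda>z. u' (fst z)" and K=k])
    fix y s m :: real assume y: "\<bar>y\<bar> \<le> R" and "\<bar>s\<bar> \<le> 0" and
      m: "\<And>r::real. \<bar>r\<bar> \<le> 0 \<Longrightarrow> norm (u (fst (y, r))) \<le> m"
    have "norm (u' y) \<le> c y * norm (u y)" by (rule K)
    also have "\<dots> \<le> k * norm (u y)"
      using k(2)[of y 0] y R_def by (intro mult_right_mono) auto
    also have "\<dots> \<le> k * m" using m[of 0] k(1) by (intro mult_left_mono) auto
    finally show "norm (u' (fst (y, s))) \<le> k * m" by simp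
  qed (use d u0 R_def in auto)
  then show ?thesis by simp
qed

lemma linear_ode_unique:
  fixes P :: "'v::real_normed_vector \<Rightarrow> 'a::real_normed_vector \<Rightarrow> 'v"
  assumes P: "bounded_bilinear P" and A: "continuous_on UNIV A"
    and y: "\<And>x. (y has_vector_derivative P (y x) (A x)) (at x)"
    and z: "\<And>x. (z has_vector_derivative P (z x) (A x)) (at x)"
    and "y 0 = z 0"
  shows "y x = z (x::real)"
proof -
  interpret P: bounded_bilinear P by fact
  obtain k where k: "k > 0" "\<And>a b. norm (P a b) \<le> norm a * norm b * k"
    using P.pos_bounded by blast
  have "(\<lambda>x. y x - z x) x = 0"
  proof (rule gronwall_ode[where c="\<lambda>x. k * norm (A x)" and u'="\<lambda>x. P (y x - z x) (A x)"])
    show "((\<lambda>x. y x - z x) has_vector_derivative P (y x - z x) (A x)) (at x)" for x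
      unfolding P.diff_left by (rule has_vector_derivative_diff[OF y z])
    show "continuous_on UNIV (\<lambda>x. k * norm (A x))" by (intro continuous_intros A)
    show "norm (P (y x - z x) (A x)) \<le> k * norm (A x) * norm (y x - z x)" for x
      using k(2) by (simp add: mult_ac)
  qed (use assms in simp)
  then show ?thesis by simp
qed

section \<open>Parallel sections of a flat connection on the plane\<close>

text \<open>
  Bootstrapping: the total derivative is a combination of \<open>P h A\<close> and \<open>P h B\<close>, which are as often
  differentiable as \<open>h\<close> itself.
\<close>

lemma parallel_section_smooth:
  fixes P :: "'v::real_normed_vector \<Rightarrow> 'a::real_normed_vector \<Rightarrow> 'v" and h :: "real \<times> real \<Rightarrow> 'v"
  assumes P: "bounded_bilinear P" and A: "smooth A" and B: "smooth B"
    and h: "continuous_on UNIV h"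
    and hx: "\<And>x t. ((\<lambda>y. h (y, t)) has_vector_derivative P (h (x, t)) (A (x, t))) (at x)"
    and ht: "\<And>x t. ((\<lambda>s. h (x, s)) has_vector_derivative P (h (x, t)) (B (x, t))) (at t)"
  shows "smooth h"
proof -
  have "C_k k h" for k
  proof (induction k)
    case (Suc k)
    have hk: "C_k k (\<lambda>z. P (h z) (A z))" "C_k k (\<lambda>z. P (h z) (B z))"
      using A B unfolding smooth_def by (auto intro!: C_k_bilinear[OF P Suc])
    show ?case
    proof (rule C_k_SucI)
      show "(h has_derivative (\<lambda>(a, b). a *\<^sub>R P (h z) (A z) + b *\<^sub>R P (h z) (B z))) (at z)" for z
        by (rule has_derivative_from_partials[OF hx ht])
          (intro bounded_bilinear.continuous_on[OF P] h smooth_continuous B)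
      show "C_k k (\<lambda>z. (\<lambda>(a, b). a *\<^sub>R P (h z) (A z) + b *\<^sub>R P (h z) (B z)) v)" for v
        using hk by (cases v) (auto intro!: C_k_add C_k_linear[OF bounded_linear_scaleR_right])
    qed
  qed (use h in simp)
  then show ?thesis by (simp add: smooth_def)
qed

text \<open>
  The hypothesis \<open>flat\<close> is the equality of the two mixed derivatives that \<open>h\<^sub>x = P h A\<close> and
  \<open>h\<^sub>t = P h B\<close> prescribe.  It enters where \<open>k(x,t) = h(x,0) + \<integral>\<^sub>0\<^sup>t P h B ds\<close> is differentiated in
  \<open>x\<close>: an integration by parts in \<open>t\<close> then gives
  \<open>u\<^sub>x = P u A - \<integral>\<^sub>0\<^sup>t P u A\<^sub>t ds\<close> for \<open>u = k - h\<close>, and \<open>u\<close> vanishes for \<open>x = 0\<close>.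
\<close>

theorem flat_connection_parallel_section:
  fixes P :: "'v::euclidean_space \<Rightarrow> 'a::real_normed_vector \<Rightarrow> 'v" and A B :: "real \<times> real \<Rightarrow> 'a"
  assumes P: "bounded_bilinear P" and A: "smooth A" and B: "smooth B"
    and flat: "\<And>v z. P v (Dt A z) + P (P v (B z)) (A z) = P v (Dx B z) + P (P v (A z)) (B z)"
  obtains h where "smooth h" "h (0, 0) = v"
    "\<And>z. Dx h z = P (h z) (A z)" "\<And>z. Dt h z = P (h z) (B z)"
proof -
  interpret P: bounded_bilinear P by fact
  have At: "smooth (Dt A)" and Bx: "smooth (Dx B)" using A B smooth_Dt smooth_Dx by blast+
  note cA = smooth_continuous[OF A] and cB = smooth_continuous[OF B]
    and cAt = smooth_continuous[OF At] and cBx = smooth_continuous[OF Bx]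
  \<comment> \<open>the section on the axis x = 0, which prescribes the initial values for the x-direction\<close>
  have "continuous_on UNIV (\<lambda>z::real \<times> real. B (0, fst z))"
    by (rule continuous_on_compose2[OF cB[of UNIV]]) (auto intro!: continuous_intros)
  then obtain G0 :: "real \<times> real \<Rightarrow> 'v" where G0: "continuous_on UNIV G0" "\<And>t. G0 (0, t) = v"
    "\<And>x t. ((\<lambda>y. G0 (y, t)) has_vector_derivative P (G0 (x, t)) (B (0, x))) (at x)"
    by (rule linear_system_with_parameter[OF P _ continuous_on_const[of UNIV v],
          where A="\<lambda>z. B (0, fst z)", unfolded fst_conv])
      blast
  define G where "G = (\<lambda>t. G0 (t, 0))"
  have G: "continuous_on UNIV G" "G 0 = v"
    "\<And>t. (G has_vector_derivative P (G t) (B (0, t))) (at t)"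
    unfolding G_def using G0 continuous_on_slice_x[OF G0(1)] by auto
  obtain h where h: "continuous_on UNIV h" and h0: "\<And>t. h (0, t) = G t"
    and hx: "\<And>x t. ((\<lambda>y. h (y, t)) has_vector_derivative P (h (x, t)) (A (x, t))) (at x)"
    using linear_system_with_parameter[OF P cA G(1)] by blast
  define k where "k = (\<lambda>(x, t). h (x, 0) + prim (\<lambda>s. P (h (x, s)) (B (x, s))) t)"
  have hB: "continuous_on UNIV (\<lambda>z. P (h z) (B z))" by (intro P.continuous_on h cB)
  have kt: "((\<lambda>s. k (x, s)) has_vector_derivative P (h (x, t)) (B (x, t))) (at t)" for x t
    unfolding k_def
    using has_vector_derivative_add[OF has_vector_derivative_const[of "h (x, 0)"]
        prim_has_vector_derivative[OF continuous_on_slice_t[OF hB, of UNIV x], of t]] by simp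
  have sw: "continuous_on UNIV (\<lambda>z. g (snd z, fst z))"
    if "continuous_on UNIV g" for g :: "real \<times> real \<Rightarrow> 'v"
    by (rule continuous_on_compose2[OF that]) (auto intro!: continuous_intros)
  have k: "continuous_on UNIV k"
  proof -
    have "continuous_on UNIV (\<lambda>z. prim (\<lambda>s. P (h (fst z, s)) (B (fst z, s))) (snd z))"
      using sw[OF prim_continuous[OF sw[OF hB]]] by simp
    moreover have "continuous_on UNIV (\<lambda>z::real \<times> real. h (fst z, 0))"
      by (rule continuous_on_compose2[OF h]) (auto intro!: continuous_intros)
    ultimately show ?thesis unfolding k_def split_def by (intro continuous_on_add)
  qed
  define Q where "Q = (\<lambda>z. P (h z) (Dx B z) + P (P (h z) (A z)) (B z))"
  have Q: "continuous_on UNIV Q" unfolding Q_def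
    by (intro continuous_on_add P.continuous_on h cA cB cBx)
  have Qd: "((\<lambda>y. P (h (y, t)) (B (y, t))) has_vector_derivative Q (x, t)) (at x)" for x t
    unfolding Q_def by (rule P.has_vector_derivative[OF hx smooth_Dx_has[OF B]])
  define u where "u = (\<lambda>z. k z - h z)"
  have u: "continuous_on UNIV u" unfolding u_def by (intro continuous_on_diff k h)
  have uAt: "continuous_on UNIV (\<lambda>z. P (u z) (Dt A z))" by (intro P.continuous_on u cAt)
  define u' where "u' = (\<lambda>(x, t). P (u (x, t)) (A (x, t)) - prim (\<lambda>s. P (u (x, s)) (Dt A (x, s))) t)"
  have ux: "((\<lambda>y. u (y, t)) has_vector_derivative u' (x, t)) (at x)" for x t
  proof -
    have "((\<lambda>y. prim (\<lambda>s. P (h (y, s)) (B (y, s))) t) has_vector_derivative prim (\<lambda>s. Q (x, s)) t) (at x)"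
      using prim_param_derivative[OF sw[OF hB] sw[OF Q], of t x] Qd by simp
    from has_vector_derivative_diff[OF has_vector_derivative_add[OF hx[of 0 x] this] hx[of t x]]
    have d: "((\<lambda>y. u (y, t)) has_vector_derivative
        P (h (x, 0)) (A (x, 0)) + prim (\<lambda>s. Q (x, s)) t - P (h (x, t)) (A (x, t))) (at x)"
      unfolding u_def k_def by simp
    define W where "W = (\<lambda>s. P (k (x, s)) (A (x, s)))"
    \<comment> \<open>flatness turns Q into a total t-derivative up to a term linear in u\<close>
    have W: "(W has_vector_derivative Q (x, s) + P (u (x, s)) (Dt A (x, s))) (at s)" for s
    proof -
      have "Q (x, s) + P (u (x, s)) (Dt A (x, s)) =
          P (k (x, s)) (Dt A (x, s)) + P (P (h (x, s)) (B (x, s))) (A (x, s))"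
        using flat[of "h (x, s)" "(x, s)"] unfolding Q_def u_def by (simp add: P.diff_left algebra_simps)
      then show ?thesis
        using P.has_vector_derivative[OF kt[of x s] smooth_Dt_has[OF A, of x s]] unfolding W_def by simp
    qed
    have cs: "continuous_on UNIV (\<lambda>s. Q (x, s))" "continuous_on UNIV (\<lambda>s. P (u (x, s)) (Dt A (x, s)))"
      using continuous_on_slice_t[OF Q] continuous_on_slice_t[OF uAt] by auto
    have "prim (\<lambda>s. Q (x, s)) t + prim (\<lambda>s. P (u (x, s)) (Dt A (x, s))) t = W t - W 0"
      using prim_eq_diff[OF continuous_on_add[OF cs] W] prim_add[OF cs] by simp
    moreover have "W 0 = P (h (x, 0)) (A (x, 0))" by (simp add: W_def k_def)
    ultimately have "P (h (x, 0)) (A (x, 0)) + prim (\<lambda>s. Q (x, s)) t - P (h (x, t)) (A (x, t)) = u' (x, t)"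
      by (simp add: u'_def u_def W_def P.diff_left algebra_simps)
    with d show ?thesis by simp
  qed
  have u0: "u (0, t) = 0" for t
  proof -
    have "prim (\<lambda>s. P (h (0, s)) (B (0, s))) t = G t - G 0"
      by (rule prim_eq_diff[OF continuous_on_slice_t[OF hB]]) (use G(3) h0 in simp)
    then show ?thesis by (simp add: u_def k_def h0)
  qed
  have "u (x, t) = 0" for x t
  proof -
    define R where "R = max \<bar>x\<bar> \<bar>t\<bar>"
    obtain a where a: "a \<ge> 0" "\<And>x t. \<bar>x\<bar> \<le> R \<Longrightarrow> \<bar>t\<bar> \<le> R \<Longrightarrow> norm (A (x, t)) \<le> a"
      using bounded_on_square[OF cA] by blast
    obtain b where b: "b \<ge> 0" "\<And>x t. \<bar>x\<bar> \<le> R \<Longrightarrow> \<bar>t\<bar> \<le> R \<Longrightarrow> norm (Dt A (x, t)) \<le> b"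
      using bounded_on_square[OF cAt] by blast
    obtain c where c: "c > 0" "\<And>v w. norm (P v w) \<le> norm v * norm w * c"
      using P.pos_bounded by blast
    show ?thesis
    proof (rule gronwall_parameter[OF u ux u0, where K="a * c + b * c * R" and T=R and R=R])
      show "\<bar>x\<bar> \<le> R" "\<bar>t\<bar> \<le> R" unfolding R_def by auto
      fix x t m assume x: "\<bar>x\<bar> \<le> R" and t: "\<bar>t\<bar> \<le> R"
        and m: "\<And>s. \<bar>s\<bar> \<le> R \<Longrightarrow> norm (u (x, s)) \<le> m"
      have m0: "m \<ge> 0" using norm_ge_zero m[OF t] by (rule order_trans)
      have "norm (P (u (x, t)) (A (x, t))) \<le> m * a * c"
        by (rule order_trans[OF c(2)])
          (use m[OF t] a(2)[OF x t] c(1) m0 a(1) in \<open>intro mult_right_mono mult_mono; simp\<close>)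
      moreover have "norm (prim (\<lambda>s. P (u (x, s)) (Dt A (x, s))) t) \<le> m * b * c * \<bar>t\<bar>"
      proof (rule prim_norm_le[OF continuous_on_slice_t[OF uAt]])
        fix s assume "\<bar>s\<bar> \<le> \<bar>t\<bar>"
        then have s: "\<bar>s\<bar> \<le> R" using t by simp
        show "norm (P (u (x, s)) (Dt A (x, s))) \<le> m * b * c"
          by (rule order_trans[OF c(2)])
            (use m[OF s] b(2)[OF x s] c(1) m0 b(1) in \<open>intro mult_right_mono mult_mono; simp\<close>)
      qed
      moreover have "m * b * c * \<bar>t\<bar> \<le> m * b * c * R"
        using t m0 b(1) c(1) by (intro mult_left_mono mult_nonneg_nonneg) auto
      ultimately have "norm (u' (x, t)) \<le> m * a * c + m * b * c * R"
        unfolding u'_def by (auto intro!: order_trans[OF norm_triangle_ineq4])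
      then show "norm (u' (x, t)) \<le> (a * c + b * c * R) * m" by (simp add: algebra_simps)
    qed
  qed
  then have "k = h" unfolding u_def by auto
  then have ht: "((\<lambda>s. h (x, s)) has_vector_derivative P (h (x, t)) (B (x, t))) (at t)" for x t
    using kt by simp
  show thesis
  proof
    show "smooth h" by (rule parallel_section_smooth[OF P A B h hx ht])
    show "h (0, 0) = v" using h0 G by simp
    show "Dx h z = P (h z) (A z)" for z using Dx_eqI[OF hx] by (cases z) simp
    show "Dt h z = P (h z) (B z)" for z using Dt_eqI[OF ht] by (cases z) simp
  qed
qed

lemma parallel_section_unique:
  fixes P :: "'v::real_normed_vector \<Rightarrow> 'a::real_normed_vector \<Rightarrow> 'v" and g h :: "real \<times> real \<Rightarrow> 'v"
  assumes P: "bounded_bilinear P" and A: "smooth A" and B: "smooth B"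
    and g: "smooth g" "\<And>z. Dx g z = P (g z) (A z)" "\<And>z. Dt g z = P (g z) (B z)"
    and h: "smooth h" "\<And>z. Dx h z = P (h z) (A z)" "\<And>z. Dt h z = P (h z) (B z)"
    and 0: "g (0, 0) = h (0, 0)"
  shows "g = h"
proof (intro ext, clarify)
  fix x t
  have "g (0, t) = h (0, t)" for t
  proof (rule linear_ode_unique[OF P, where A="\<lambda>t. B (0, t)" and y="\<lambda>t. g (0, t)"
        and z="\<lambda>t. h (0, t)"])
    show "((\<lambda>t. g (0, t)) has_vector_derivative P (g (0, t)) (B (0, t))) (at t)"
      "((\<lambda>t. h (0, t)) has_vector_derivative P (h (0, t)) (B (0, t))) (at t)" for t
      using smooth_Dt_has[OF g(1), of 0 t] smooth_Dt_has[OF h(1), of 0 t] by (simp_all only: g(3) h(3))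
  qed (use continuous_on_slice_t[OF smooth_continuous[OF B]] 0 in simp_all)
  note t = this
  show "g (x, t) = h (x, t)"
  proof (rule linear_ode_unique[OF P, where A="\<lambda>x. A (x, t)" and y="\<lambda>x. g (x, t)"
        and z="\<lambda>x. h (x, t)"])
    show "((\<lambda>x. g (x, t)) has_vector_derivative P (g (x, t)) (A (x, t))) (at x)"
      "((\<lambda>x. h (x, t)) has_vector_derivative P (h (x, t)) (A (x, t))) (at x)" for x
      using smooth_Dx_has[OF g(1), of t x] smooth_Dx_has[OF h(1), of t x] by (simp_all only: g(2) h(2))
  qed (use continuous_on_slice_x[OF smooth_continuous[OF A]] t in simp_all)
qed

section \<open>Uniqueness of rapidly decaying KdV solutions\<close>

lemma scalar_gronwall_half:
  fixes e :: "real \<Rightarrow> real"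
  assumes d: "\<And>s. (e has_real_derivative e' s) (at s)" and e0: "e 0 = 0" and C: "C > 0"
    and \<epsilon>: "\<epsilon> \<ge> 0" and b: "\<And>s. 0 \<le> s \<Longrightarrow> s \<le> t \<Longrightarrow> e' s \<le> C * e s + \<epsilon>" and t: "0 \<le> t"
  shows "e t \<le> \<epsilon> / C * exp (C * t)"
proof -
  define f where "f = (\<lambda>s. (e s + \<epsilon> / C) * exp (- (C * s)))"
  have "f t \<le> f 0"
  proof (rule DERIV_nonpos_imp_nonincreasing[OF t])
    fix s assume s: "0 \<le> s" "s \<le> t"
    have "(f has_real_derivative (e' s - C * (e s + \<epsilon> / C)) * exp (- (C * s))) (at s)"
      unfolding f_def by (rule derivative_eq_intros d refl | simp add: algebra_simps)+
    moreover have "(e' s - C * (e s + \<epsilon> / C)) * exp (- (C * s)) \<le> 0"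
      using b[OF s] C by (intro mult_nonpos_nonneg) (auto simp: algebra_simps)
    ultimately show "\<exists>y. (f has_real_derivative y) (at s) \<and> y \<le> 0" by blast
  qed
  then have "e t + \<epsilon> / C \<le> \<epsilon> / C * exp (C * t)"
    by (simp add: f_def e0 exp_minus field_simps)
  moreover have "\<epsilon> / C \<ge> 0" using \<epsilon> C by simp
  ultimately show ?thesis by simp
qed

lemma scalar_gronwall:
  fixes e :: "real \<Rightarrow> real"
  assumes d: "\<And>s. (e has_real_derivative e' s) (at s)" and e0: "e 0 = 0" and C: "C > 0"
    and \<epsilon>: "\<epsilon> \<ge> 0" and b: "\<And>s. \<bar>s\<bar> \<le> \<bar>t\<bar> \<Longrightarrow> \<bar>e' s\<bar> \<le> C * e s + \<epsilon>"
  shows "e t \<le> \<epsilon> / C * exp (C * \<bar>t\<bar>)"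
proof (cases "0 \<le> t")
  case True
  have "e' s \<le> C * e s + \<epsilon>" if "0 \<le> s" "s \<le> t" for s
    using b[of s] that by simp
  from scalar_gronwall_half[OF d e0 C \<epsilon> this True] show ?thesis using True by simp
next
  case False
  have "((\<lambda>s. e (- s)) has_real_derivative - e' (- s)) (at s)" for s
  proof -
    have "(uminus has_real_derivative -1) (at s)" by (auto intro!: derivative_eq_intros)
    from DERIV_chain2[OF d this] show ?thesis by simp
  qed
  moreover have "- e' (- s) \<le> C * e (- s) + \<epsilon>" if "0 \<le> s" "s \<le> - t" for s
    using b[of "- s"] that by simp
  ultimately show ?thesis
    using scalar_gronwall_half[of "\<lambda>s. e (- s)" "\<lambda>s. - e' (- s)" C \<epsilon> "- t"] e0 C \<epsilon> False by simp
qed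

text \<open>
  The part of rapid decay that the energy estimate uses: bounds for \<open>f\<close> and \<open>x f\<close>, locally uniform in
  \<open>t\<close>.
\<close>

definition decays :: "(real \<times> real \<Rightarrow> real) \<Rightarrow> bool" where
  "decays f \<longleftrightarrow> (\<forall>T. \<exists>c. \<forall>x t. \<bar>t\<bar> \<le> T \<longrightarrow> \<bar>f (x, t)\<bar> \<le> c \<and> \<bar>x * f (x, t)\<bar> \<le> c)"

lemma decays_add:
  assumes "decays f" "decays g"
  shows "decays (\<lambda>z. f z + g z)"
  unfolding decays_def
proof
  fix T
  obtain c d where "\<And>x t. \<bar>t\<bar> \<le> T \<Longrightarrow> \<bar>f (x, t)\<bar> \<le> c \<and> \<bar>x * f (x, t)\<bar> \<le> c"
    "\<And>x t. \<bar>t\<bar> \<le> T \<Longrightarrow> \<bar>g (x, t)\<bar> \<le> d \<and> \<bar>x * g (x, t)\<bar> \<le> d"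
    using assms unfolding decays_def by metis
  then have "\<bar>f (x, t) + g (x, t)\<bar> \<le> c + d \<and> \<bar>x * (f (x, t) + g (x, t))\<bar> \<le> c + d"
    if "\<bar>t\<bar> \<le> T" for x t
    using that unfolding distrib_left by (meson abs_triangle_ineq add_mono order_trans)
  then show "\<exists>c. \<forall>x t. \<bar>t\<bar> \<le> T \<longrightarrow> \<bar>f (x, t) + g (x, t)\<bar> \<le> c \<and> \<bar>x * (f (x, t) + g (x, t))\<bar> \<le> c"
    by blast
qed

lemma decays_minus: "decays f \<Longrightarrow> decays (\<lambda>z. - f z)"
  by (simp add: decays_def)

lemma decays_diff: "decays f \<Longrightarrow> decays g \<Longrightarrow> decays (\<lambda>z. f z - g z)"
  using decays_add[of f "\<lambda>z. - g z"] decays_minus[of g] by simp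

lemma rapidly_decaying_decays:
  assumes "rapidly_decaying_loc_unif q"
  shows "decays ((Dx ^^ n) q)"
  unfolding decays_def
proof
  fix T :: real
  have K: "compact {-T..T}" by simp
  note b = assms[unfolded rapidly_decaying_loc_unif_def, rule_format, OF K]
  obtain c where c: "\<And>x t. t \<in> {-T..T} \<Longrightarrow> \<bar>x ^ 0 * (Dx ^^ n) q (x, t)\<bar> \<le> c"
    using b[of 0 n] by blast
  obtain d where d: "\<And>x t. t \<in> {-T..T} \<Longrightarrow> \<bar>x ^ 1 * (Dx ^^ n) q (x, t)\<bar> \<le> d"
    using b[of 1 n] by blast
  have "\<bar>(Dx ^^ n) q (x, t)\<bar> \<le> max c d \<and> \<bar>x * (Dx ^^ n) q (x, t)\<bar> \<le> max c d" if "\<bar>t\<bar> \<le> T" for x t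
  proof -
    have "t \<in> {-T..T}" using that by auto
    from c[OF this, of x] d[OF this, of x] show ?thesis by (simp add: le_max_iff_disj)
  qed
  then show "\<exists>c. \<forall>x t. \<bar>t\<bar> \<le> T \<longrightarrow> \<bar>(Dx ^^ n) q (x, t)\<bar> \<le> c \<and> \<bar>x * (Dx ^^ n) q (x, t)\<bar> \<le> c" by blast
qed

lemma Dx_add:
  assumes "smooth f" "smooth g"
  shows "Dx (\<lambda>z. f z + g z) = (\<lambda>z. Dx f z + Dx g z)"
proof (intro ext, clarify)
  fix x t
  show "Dx (\<lambda>z. f z + g z) (x, t) = Dx f (x, t) + Dx g (x, t)"
    by (rule Dx_eqI[OF has_vector_derivative_add[OF assms[THEN smooth_Dx_has]]])
qed

lemma Dx_diff:
  assumes "smooth f" "smooth g"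
  shows "Dx (\<lambda>z. f z - g z) = (\<lambda>z. Dx f z - Dx g z)"
proof (intro ext, clarify)
  fix x t
  show "Dx (\<lambda>z. f z - g z) (x, t) = Dx f (x, t) - Dx g (x, t)"
    by (rule Dx_eqI[OF has_vector_derivative_diff[OF assms[THEN smooth_Dx_has]]])
qed

lemma Dt_diff:
  assumes "smooth f" "smooth g"
  shows "Dt (\<lambda>z. f z - g z) = (\<lambda>z. Dt f z - Dt g z)"
proof (intro ext, clarify)
  fix x t
  show "Dt (\<lambda>z. f z - g z) (x, t) = Dt f (x, t) - Dt g (x, t)"
    by (rule Dt_eqI[OF has_vector_derivative_diff[OF assms[THEN smooth_Dt_has]]])
qed

lemma smooth_Dx_has_real:
  "smooth (f :: real \<times> real \<Rightarrow> real) \<Longrightarrow> ((\<lambda>y. f (y, t)) has_real_derivative Dx f (x, t)) (at x)"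
  by (simp add: smooth_Dx_has has_real_derivative_iff_has_vector_derivative)

lemma smooth_Dt_has_real:
  "smooth (f :: real \<times> real \<Rightarrow> real) \<Longrightarrow> ((\<lambda>s. f (x, s)) has_real_derivative Dt f (x, t)) (at t)"
  by (simp add: smooth_Dt_has has_real_derivative_iff_has_vector_derivative)

text \<open>
  Energy method.  With \<open>w = p - q\<close> and \<open>s = p + q\<close> the nonlinear terms combine to
  \<open>p p\<^sub>x - q q\<^sub>x = (s w)\<^sub>x / 2\<close>, and \<open>2 w w\<^sub>t = \<Phi>\<^sub>x - 3/4 s\<^sub>x w\<^sup>2\<close> for a flux \<open>\<Phi>\<close> that is a polynomial in
  \<open>w\<close>, \<open>w\<^sub>x\<close>, \<open>w\<^sub>x\<^sub>x\<close> and \<open>s\<close>.  Hence the energy \<open>e R t = \<integral> w\<^sup>2 dx\<close> over \<open>[-R, R]\<close> satisfies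
  \<open>\<bar>e'\<bar> \<le> C e + 2 M / R\<close>, where the boundary terms are \<open>O(1/R)\<close> by decay.  Gronwall gives
  \<open>e R t = O(1/R)\<close> while \<open>e R t\<close> increases with \<open>R\<close>, so it vanishes.  Working on bounded intervals
  avoids differentiating an integral over the whole line.
\<close>

lemma kdv_unique:
  assumes p: "kdv_solution p" "rapidly_decaying_loc_unif p"
    and q: "kdv_solution q" "rapidly_decaying_loc_unif q"
    and init: "\<And>x. p (x, 0) = q (x, 0)"
  shows "p = q"
proof -
  have sp: "smooth p" "smooth (Dx p)" "smooth (Dx (Dx p))"
    and sq: "smooth q" "smooth (Dx q)" "smooth (Dx (Dx q))"
    using p(1) q(1) by (auto simp: kdv_solution_def intro!: smooth_Dx)
  define w where "w = (\<lambda>z. p z - q z)"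
  define s where "s = (\<lambda>z. p z + q z)"
  have sw: "smooth w" "smooth s" unfolding w_def s_def
    using sp sq by (auto intro: smooth_diff smooth_add)
  then have sm: "smooth (Dx w)" "smooth (Dx (Dx w))" "smooth (Dx s)" "smooth (Dt w)"
    by (auto intro: smooth_Dx smooth_Dt)
  have w1: "Dx w = (\<lambda>z. Dx p z - Dx q z)" unfolding w_def using Dx_diff sp sq by blast
  have w2: "Dx (Dx w) = (\<lambda>z. Dx (Dx p) z - Dx (Dx q) z)" unfolding w1 using Dx_diff sp sq by blast
  have w3: "Dx (Dx (Dx w)) = (\<lambda>z. Dx (Dx (Dx p)) z - Dx (Dx (Dx q)) z)"
    unfolding w2 using Dx_diff sp sq by blast
  have s1: "Dx s = (\<lambda>z. Dx p z + Dx q z)" unfolding s_def using Dx_add sp sq by blast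
  have wt: "Dt w = (\<lambda>z. Dt p z - Dt q z)" unfolding w_def using Dt_diff sp sq by blast
  have pn: "decays p" "decays (Dx p)" "decays (Dx (Dx p))"
    using rapidly_decaying_decays[OF p(2), of 0] rapidly_decaying_decays[OF p(2), of 1]
      rapidly_decaying_decays[OF p(2), of 2] by (simp_all add: numeral_2_eq_2)
  have qn: "decays q" "decays (Dx q)" "decays (Dx (Dx q))"
    using rapidly_decaying_decays[OF q(2), of 0] rapidly_decaying_decays[OF q(2), of 1]
      rapidly_decaying_decays[OF q(2), of 2] by (simp_all add: numeral_2_eq_2)
  have dec: "decays w" "decays (Dx w)" "decays (Dx (Dx w))" "decays s" "decays (Dx s)"
  proof -
    show "decays (Dx (Dx w))" unfolding w2 by (rule decays_diff[OF pn(3) qn(3)])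
    show "decays (Dx w)" unfolding w1 by (rule decays_diff[OF pn(2) qn(2)])
    show "decays (Dx s)" unfolding s1 by (rule decays_add[OF pn(2) qn(2)])
    show "decays w" unfolding w_def by (rule decays_diff[OF pn(1) qn(1)])
    show "decays s" unfolding s_def by (rule decays_add[OF pn(1) qn(1)])
  qed
  define \<Phi> where "\<Phi> = (\<lambda>z. 1/2 * (w z * Dx (Dx w) z) - 1/4 * (Dx w z)\<^sup>2 - 3/4 * (s z * (w z)\<^sup>2))"
  have energy_identity: "((\<lambda>y. \<Phi> (y, t)) has_real_derivative
      2 * w (x, t) * Dt w (x, t) + 3/4 * Dx s (x, t) * (w (x, t))\<^sup>2) (at x)" for x t
  proof -
    have "Dt w (x, t) = 1/4 * (Dx (Dx (Dx w)) (x, t) - 3 * (Dx s (x, t) * w (x, t) + s (x, t) * Dx w (x, t)))"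
    proof -
      have "Dt p (x, t) = 1/4 * (Dx (Dx (Dx p)) (x, t) - 6 * p (x, t) * Dx p (x, t))"
        "Dt q (x, t) = 1/4 * (Dx (Dx (Dx q)) (x, t) - 6 * q (x, t) * Dx q (x, t))"
        using p(1) q(1) unfolding kdv_solution_def by blast+
      then show ?thesis
        unfolding wt w3 unfolding w1 s1 unfolding w_def s_def by (simp add: algebra_simps)
    qed
    note wt = this
    note d = smooth_Dx_has_real[OF sw(1), of t x] smooth_Dx_has_real[OF sw(2), of t x]
      smooth_Dx_has_real[OF sm(1), of t x] smooth_Dx_has_real[OF sm(2), of t x]
    have "((\<lambda>y. \<Phi> (y, t)) has_real_derivative
      (w (x, t) * Dx (Dx (Dx w)) (x, t)) / 2
        - 3/4 * (Dx s (x, t) * (w (x, t))\<^sup>2 + s (x, t) * (2 * w (x, t) * Dx w (x, t)))) (at x)"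
      unfolding \<Phi>_def
      by (auto intro!: derivative_eq_intros d simp: field_simps power2_eq_square)
    then show ?thesis
      by (rule DERIV_cong) (simp add: wt algebra_simps power2_eq_square)
  qed
  have "w (x0, t0) = 0" for x0 t0
  proof -
    define T where "T = \<bar>t0\<bar>"
    note bnd = dec[unfolded decays_def, THEN spec[of _ T]]
    obtain c1 where c1: "\<And>x t. \<bar>t\<bar> \<le> T \<Longrightarrow> \<bar>w (x, t)\<bar> \<le> c1 \<and> \<bar>x * w (x, t)\<bar> \<le> c1"
      using bnd(1) by blast
    obtain c2 where c2: "\<And>x t. \<bar>t\<bar> \<le> T \<Longrightarrow> \<bar>Dx w (x, t)\<bar> \<le> c2 \<and> \<bar>x * Dx w (x, t)\<bar> \<le> c2"
      using bnd(2) by blast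
    obtain c3 where c3: "\<And>x t. \<bar>t\<bar> \<le> T \<Longrightarrow> \<bar>Dx (Dx w) (x, t)\<bar> \<le> c3"
      using bnd(3) by blast
    obtain c4 where c4: "\<And>x t. \<bar>t\<bar> \<le> T \<Longrightarrow> \<bar>s (x, t)\<bar> \<le> c4"
      using bnd(4) by blast
    obtain c5 where c5: "\<And>x t. \<bar>t\<bar> \<le> T \<Longrightarrow> \<bar>Dx s (x, t)\<bar> \<le> c5"
      using bnd(5) by blast
    note c = c1 c2 c3 c4 c5
    have T0: "\<bar>0\<bar> \<le> T" unfolding T_def by simp
    have cpos: "c1 \<ge> 0" "c2 \<ge> 0" "c3 \<ge> 0" "c4 \<ge> 0" "c5 \<ge> 0"
      using c1[OF T0, of 0] c2[OF T0, of 0] c3[OF T0, of 0] c4[OF T0, of 0] c5[OF T0, of 0] by linarith+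
    define M where "M = 1/2 * (c1 * c3) + 1/4 * (c2 * c2) + 3/4 * (c4 * (c1 * c1))"
    have flux: "\<bar>x * \<Phi> (x, t)\<bar> \<le> M" if t: "\<bar>t\<bar> \<le> T" for x t
    proof -
      have tri: "\<bar>1/2 * A - 1/4 * B - 3/4 * D\<bar> \<le> 1/2 * a + 1/4 * b + 3/4 * d"
        if "\<bar>A\<bar> \<le> a" "\<bar>B\<bar> \<le> b" "\<bar>D\<bar> \<le> d" for A B D a b d :: real
        using that by linarith
      have "x * \<Phi> (x, t) = 1/2 * ((x * w (x, t)) * Dx (Dx w) (x, t)) - 1/4 * ((x * Dx w (x, t)) * Dx w (x, t))
          - 3/4 * (s (x, t) * ((x * w (x, t)) * w (x, t)))"
        by (simp add: \<Phi>_def power2_eq_square algebra_simps)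
      moreover have "\<bar>(x * w (x, t)) * Dx (Dx w) (x, t)\<bar> \<le> c1 * c3"
        "\<bar>(x * Dx w (x, t)) * Dx w (x, t)\<bar> \<le> c2 * c2"
        "\<bar>s (x, t) * ((x * w (x, t)) * w (x, t))\<bar> \<le> c4 * (c1 * c1)"
        unfolding abs_mult[of "s _"] abs_mult[of "_ * w _"] abs_mult[of "_ * Dx w _"]
        using c[OF t] cpos by (intro mult_mono mult_nonneg_nonneg; simp)+
      ultimately show ?thesis unfolding M_def by (simp only: tri)
    qed
    have M: "M \<ge> 0" using order_trans[OF abs_ge_zero flux[OF T0]] .
    \<comment> \<open>the summand 1 makes C positive, as dividing by C requires\<close>
    define C where "C = 3/4 * c5 + 1"
    have C: "C > 0" unfolding C_def using cpos by simp
    define e where "e = (\<lambda>R t. integral {-R..R} (\<lambda>x. (w (x, t))\<^sup>2))"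
    have w2c: "continuous_on S (\<lambda>x. (w (x, t))\<^sup>2)" for S t
      by (intro continuous_intros smooth_continuous smooth_slice_x sw)
    have bound: "e R t0 \<le> (2 * M / R) / C * exp (C * \<bar>t0\<bar>)" if R: "R > 0" for R
    proof (rule scalar_gronwall)
      fix t
      let ?f' = "\<lambda>z. 2 * w z * Dt w z"
      have "smooth ?f'" by (intro smooth_mult smooth_const sw sm)
      then have c': "continuous_on S ?f'" for S by (rule smooth_continuous)
      have "((\<lambda>t. integral (cbox (-R) R) (\<lambda>x. (w (x, t))\<^sup>2)) has_vector_derivative
          integral (cbox (-R) R) (\<lambda>x. ?f' (x, t))) (at t within UNIV)"
      proof (rule leibniz_rule_vector_derivative)
        show "((\<lambda>t. (w (x, t))\<^sup>2) has_vector_derivative ?f' (x, t)) (at t within UNIV)" for x t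
          unfolding has_real_derivative_iff_has_vector_derivative[symmetric]
          using smooth_Dt_has_real[OF sw(1), of x t] by (auto intro!: derivative_eq_intros)
        show "(\<lambda>x. (w (x, t))\<^sup>2) integrable_on cbox (-R) R" for t
          by (intro integrable_continuous w2c)
        have "continuous_on (UNIV \<times> cbox (-R) R) (\<lambda>v. ?f' (snd v, fst v))"
          by (rule continuous_on_compose2[OF c'[of UNIV]]) (auto intro!: continuous_intros)
        then show "continuous_on (UNIV \<times> cbox (-R) R) (\<lambda>(t, x). ?f' (x, t))" by (simp add: split_def)
      qed auto
      then show "(e R has_real_derivative integral {-R..R} (\<lambda>x. ?f' (x, t))) (at t)"
        by (simp add: e_def has_real_derivative_iff_has_vector_derivative)
    next
      fix t assume "\<bar>t\<bar> \<le> \<bar>t0\<bar>"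
      then have t: "\<bar>t\<bar> \<le> T" unfolding T_def .
      let ?h = "\<lambda>x. 3/4 * Dx s (x, t) * (w (x, t))\<^sup>2"
      have hc: "continuous_on S ?h" for S
        by (intro continuous_intros smooth_continuous smooth_slice_x sw sm)
      have "((\<lambda>x. 2 * w (x, t) * Dt w (x, t) + ?h x) has_integral \<Phi> (R, t) - \<Phi> (-R, t)) {-R..R}"
      proof (rule fundamental_theorem_of_calculus)
        show "-R \<le> R" using R by simp
        show "((\<lambda>y. \<Phi> (y, t)) has_vector_derivative 2 * w (x, t) * Dt w (x, t) + ?h x) (at x within {-R..R})" for x
          unfolding has_real_derivative_iff_has_vector_derivative[symmetric]
          by (rule has_field_derivative_at_within[OF energy_identity])
      qed
      moreover have "(?h has_integral integral {-R..R} ?h) {-R..R}"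
        by (intro integrable_integral integrable_continuous_real hc)
      ultimately have "((\<lambda>x. (2 * w (x, t) * Dt w (x, t) + ?h x) - ?h x) has_integral
          \<Phi> (R, t) - \<Phi> (-R, t) - integral {-R..R} ?h) {-R..R}"
        by (rule has_integral_diff)
      then have "((\<lambda>x. 2 * w (x, t) * Dt w (x, t)) has_integral
          \<Phi> (R, t) - \<Phi> (-R, t) - integral {-R..R} ?h) {-R..R}"
        by (simp only: add_diff_cancel_right')
      then have eq: "integral {-R..R} (\<lambda>x. 2 * w (x, t) * Dt w (x, t)) = \<Phi> (R, t) - \<Phi> (-R, t) - integral {-R..R} ?h"
        by (rule integral_unique)
      have "\<bar>\<Phi> (R, t)\<bar> \<le> M / R" "\<bar>\<Phi> (-R, t)\<bar> \<le> M / R"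
        using flux[OF t, of R] flux[OF t, of "-R"] R by (simp_all add: abs_mult field_simps)
      moreover have "norm (integral {-R..R} ?h) \<le> integral {-R..R} (\<lambda>x. C * (w (x, t))\<^sup>2)"
      proof (rule integral_norm_bound_integral)
        show "?h integrable_on {-R..R}" by (intro integrable_continuous_real hc)
        show "(\<lambda>x. C * (w (x, t))\<^sup>2) integrable_on {-R..R}"
          by (intro integrable_continuous_real continuous_on_mult continuous_on_const w2c)
        fix x
        have "\<bar>3/4 * Dx s (x, t)\<bar> * (w (x, t))\<^sup>2 \<le> C * (w (x, t))\<^sup>2"
          using c(5)[OF t, of x] unfolding C_def by (intro mult_right_mono) auto
        then show "norm (?h x) \<le> C * (w (x, t))\<^sup>2" by (simp add: abs_mult)
      qed
      moreover have "integral {-R..R} (\<lambda>x. C * (w (x, t))\<^sup>2) = C * e R t" by (simp add: e_def)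
      ultimately show "\<bar>integral {-R..R} (\<lambda>x. 2 * w (x, t) * Dt w (x, t))\<bar> \<le> C * e R t + 2 * M / R"
        unfolding eq real_norm_def times_divide_eq_right[symmetric] by linarith
    next
      show "e R 0 = 0" using init by (simp add: e_def w_def)
    qed (use C M R in auto)
    define R0 where "R0 = \<bar>x0\<bar> + 1"
    have "e R0 t0 \<le> 2 * M / C * exp (C * \<bar>t0\<bar>) / R" if "R \<ge> R0" for R
    proof -
      have "R > 0" using that unfolding R0_def by linarith
      have "e R0 t0 \<le> e R t0" unfolding e_def
        by (rule integral_subset_le) (use that in \<open>auto intro!: integrable_continuous_real w2c\<close>)
      with bound[OF \<open>R > 0\<close>] show ?thesis by (simp add: field_simps)
    qed
    then have ev: "\<forall>\<^sub>F R in at_top. e R0 t0 \<le> 2 * M / C * exp (C * \<bar>t0\<bar>) / R"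
      unfolding eventually_at_top_linorder by blast
    have "((\<lambda>R. 2 * M / C * exp (C * \<bar>t0\<bar>) / R) \<longlongrightarrow> 0) at_top"
      by (rule tendsto_divide_0[OF tendsto_const filterlim_at_top_imp_at_infinity[OF filterlim_ident]])
    from tendsto_lowerbound[OF this ev] have "e R0 t0 \<le> 0" by simp
    moreover have "e R0 t0 \<ge> 0" unfolding e_def by (intro integral_nonneg integrable_continuous_real w2c) simp
    ultimately have "integral {-R0..R0} (\<lambda>x. (w (x, t0))\<^sup>2) = 0" unfolding e_def by simp
    moreover have "- R0 < R0" "x0 \<in> {-R0..R0}" unfolding R0_def by auto
    ultimately show ?thesis using integral_eq_0_iff[OF w2c, of "-R0" R0 t0] by auto
  qed
  then show ?thesis unfolding w_def by auto
qed

section \<open>Two-by-two matrices\<close>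

lemma bounded_bilinear_matrix_mult:
  "bounded_bilinear ((**) :: real ^ 'n ^ 'm \<Rightarrow> real ^ 'k ^ 'n \<Rightarrow> real ^ 'k ^ 'm)"
  unfolding bilinear_conv_bounded_bilinear[symmetric] bilinear_def
  by (auto intro!: linearI
      simp: vec_eq_iff matrix_matrix_mult_def sum.distrib sum_distrib_left algebra_simps)

lemma bounded_linear_matrix_vector_left:
  "bounded_linear (\<lambda>M :: real ^ 'n ^ 'm. M *v v)"
  unfolding linear_conv_bounded_linear[symmetric]
  by (auto intro!: linearI simp: matrix_vector_mult_add_rdistrib scaleR_matrix_vector_assoc)

lemma mat_of_entries_nth [simp]:
  "mat_of_entries a b c d $ 1 $ 1 = a" "mat_of_entries a b c d $ 1 $ 2 = b"
  "mat_of_entries a b c d $ 2 $ 1 = c" "mat_of_entries a b c d $ 2 $ 2 = d"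
  by (simp_all add: mat_of_entries_def)

lemma mat_of_cols_nth [simp]:
  "mat_of_cols u v $ i $ 1 = u $ i" "mat_of_cols u v $ i $ 2 = v $ i"
  by (simp_all add: mat_of_cols_def transpose_def)

lemma det_mat_of_cols: "det (mat_of_cols u v) = u $ 1 * v $ 2 - v $ 1 * u $ 2"
  by (simp add: det_2)

lemma mat_of_cols_mult:
  "mat_of_cols u v ** mat_of_entries a b c d = mat_of_cols (a *\<^sub>R u + c *\<^sub>R v) (b *\<^sub>R u + d *\<^sub>R v)"
  by (simp add: vec_eq_iff forall_2 matrix_matrix_mult_def sum_2 mult.commute)

lemma mat_of_entries_mult:
  "mat_of_entries a b c d ** mat_of_entries a' b' c' d' =
     mat_of_entries (a * a' + b * c') (a * b' + b * d') (c * a' + d * c') (c * b' + d * d')"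
  by (simp add: vec_eq_iff forall_2 matrix_matrix_mult_def sum_2)

lemma mat_of_entries_add:
  "mat_of_entries a b c d + mat_of_entries a' b' c' d' = mat_of_entries (a + a') (b + b') (c + c') (d + d')"
  by (simp add: vec_eq_iff forall_2)

lemma mat_of_entries_expand:
  "mat_of_entries a b c d = a *\<^sub>R mat_of_entries 1 0 0 0 + b *\<^sub>R mat_of_entries 0 1 0 0
     + c *\<^sub>R mat_of_entries 0 0 1 0 + d *\<^sub>R mat_of_entries 0 0 0 1"
  by (simp add: vec_eq_iff forall_2)

lemma smooth_mat_of_entries:
  assumes "smooth a" "smooth b" "smooth c" "smooth d"
  shows "smooth (\<lambda>z. mat_of_entries (a z) (b z) (c z) (d z))"
  unfolding mat_of_entries_expand[of "a _"]
  by (intro smooth_add smooth_scaleR smooth_const assms)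

lemma mat_of_entries_has_vector_derivative:
  assumes "(a has_vector_derivative a') (at x)" "(b has_vector_derivative b') (at x)"
    "(c has_vector_derivative c') (at x)" "(d has_vector_derivative d') (at x)"
  shows "((\<lambda>y. mat_of_entries (a y) (b y) (c y) (d y)) has_vector_derivative mat_of_entries a' b' c' d') (at x)"
  unfolding mat_of_entries_expand[of "a _"] mat_of_entries_expand[of a']
  by (intro has_vector_derivative_add
      bounded_linear.has_vector_derivative[OF bounded_linear_scaleR_left] assms)

lemma mat_of_cols_entries: "mat_of_cols u v = mat_of_entries (u $ 1) (v $ 1) (u $ 2) (v $ 2)"
  by (simp add: vec_eq_iff forall_2)

lemma smooth_mat_of_cols:
  assumes "smooth u" "smooth v"
  shows "smooth (\<lambda>z. mat_of_cols (u z) (v z))"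
  unfolding mat_of_cols_entries by (intro smooth_mat_of_entries smooth_nth assms)

lemma mat_of_cols_has_vector_derivative:
  assumes "(u has_vector_derivative u') (at x)" "(v has_vector_derivative v') (at x)"
  shows "((\<lambda>y. mat_of_cols (u y) (v y)) has_vector_derivative mat_of_cols u' v') (at x)"
  unfolding mat_of_cols_entries
  by (intro mat_of_entries_has_vector_derivative
      bounded_linear.has_vector_derivative[OF bounded_linear_vec_nth] assms)

text \<open>
  Liouville's formula \<open>(det y)' = tr M det y\<close> in the trace-free case.
\<close>

lemma det_constant:
  fixes y :: "real \<Rightarrow> real ^ 2 ^ 2"
  assumes y: "\<And>x. (y has_vector_derivative y x ** M x) (at x)"
    and tr: "\<And>x. M x $ 1 $ 1 + M x $ 2 $ 2 = 0"
  shows "det (y x) = det (y 0)"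
proof -
  have e: "((\<lambda>x. y x $ i $ j) has_real_derivative (y x ** M x) $ i $ j) (at x)" for i j x
    unfolding has_real_derivative_iff_has_vector_derivative
    by (intro bounded_linear.has_vector_derivative[OF bounded_linear_vec_nth] y)
  have "((\<lambda>x. det (y x)) has_real_derivative 0) (at x)" for x
  proof -
    have "((\<lambda>x. det (y x)) has_real_derivative
      (y x ** M x) $ 1 $ 1 * y x $ 2 $ 2 + (y x ** M x) $ 2 $ 2 * y x $ 1 $ 1
      - ((y x ** M x) $ 1 $ 2 * y x $ 2 $ 1 + (y x ** M x) $ 2 $ 1 * y x $ 1 $ 2)) (at x)"
      unfolding det_2 by (intro DERIV_diff DERIV_mult e)
    moreover have "(y x ** M x) $ 1 $ 1 * y x $ 2 $ 2 + (y x ** M x) $ 2 $ 2 * y x $ 1 $ 1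
      - ((y x ** M x) $ 1 $ 2 * y x $ 2 $ 1 + (y x ** M x) $ 2 $ 1 * y x $ 1 $ 2)
      = (M x $ 1 $ 1 + M x $ 2 $ 2) * det (y x)"
      by (simp add: matrix_matrix_mult_def sum_2 det_2 algebra_simps)
    ultimately show ?thesis using tr[of x] by simp
  qed
  then show ?thesis using DERIV_isconst_all by blast
qed

section \<open>Central affine curvature of a plane curve\<close>

lemma central_affine_curvature_eqI:
  assumes "\<And>x. \<gamma> x \<noteq> 0" "smooth q" "\<And>x. D (D \<gamma>) x = q x *\<^sub>R \<gamma> x"
  shows "central_affine_curvature \<gamma> = q"
  unfolding central_affine_curvature_def
proof (rule the_equality)
  fix r assume "smooth r \<and> (\<forall>x. D (D \<gamma>) x = r x *\<^sub>R \<gamma> x)"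
  then have "r x *\<^sub>R \<gamma> x = q x *\<^sub>R \<gamma> x" for x using assms(3) by metis
  then show "r = q" using assms(1) by auto
qed (use assms in auto)

lemma smooth_det_mat_of_cols:
  assumes "smooth u" "smooth v"
  shows "smooth (\<lambda>z. det (mat_of_cols (u z) (v z)))"
  unfolding det_mat_of_cols by (intro smooth_diff smooth_mult smooth_nth assms)

text \<open>
  Differentiating \<open>det(\<gamma>, \<gamma>\<^sub>x) = 1\<close> gives \<open>det(\<gamma>, \<gamma>\<^sub>x\<^sub>x) = 0\<close>, so \<open>\<gamma>\<^sub>x\<^sub>x\<close> is a multiple of \<open>\<gamma>\<close>, and the
  factor is read off by pairing with \<open>\<gamma>\<^sub>x\<close>.  The determinant formula shows that the curvature of a
  smooth family of curves is smooth in both variables.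
\<close>

lemma M2_curvature:
  assumes "\<gamma> \<in> M2"
  shows "central_affine_curvature \<gamma> = (\<lambda>x. det (mat_of_cols (D (D \<gamma>) x) (D \<gamma> x)))"
    and "D (D \<gamma>) x = central_affine_curvature \<gamma> x *\<^sub>R \<gamma> x"
proof -
  have s: "smooth \<gamma>" "smooth (D \<gamma>)" "smooth (D (D \<gamma>))" and n0: "\<And>x. \<gamma> x \<noteq> 0"
    and det: "\<And>x. det (mat_of_cols (\<gamma> x) (D \<gamma> x)) = 1"
    using assms by (auto simp: M2_def intro!: smooth_D)
  let ?\<kappa> = "\<lambda>x. det (mat_of_cols (D (D \<gamma>) x) (D \<gamma> x))"
  have c: "((\<lambda>x. f x $ i) has_real_derivative D f x $ i) (at x)" if "smooth f" for f :: "real \<Rightarrow> real ^ 2" and i x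
    unfolding has_real_derivative_iff_has_vector_derivative
    by (intro bounded_linear.has_vector_derivative[OF bounded_linear_vec_nth] smooth_D(1) that)
  have eq: "D (D \<gamma>) x = ?\<kappa> x *\<^sub>R \<gamma> x" for x
  proof -
    have "((\<lambda>x. det (mat_of_cols (\<gamma> x) (D \<gamma> x))) has_real_derivative
      (D \<gamma> x $ 1 * D \<gamma> x $ 2 + D (D \<gamma>) x $ 2 * \<gamma> x $ 1)
      - (D (D \<gamma>) x $ 1 * \<gamma> x $ 2 + D \<gamma> x $ 2 * D \<gamma> x $ 1)) (at x)"
      unfolding det_mat_of_cols by (intro DERIV_diff DERIV_mult c s)
    then have e: "((\<lambda>x. 1) has_real_derivative
      (D \<gamma> x $ 1 * D \<gamma> x $ 2 + D (D \<gamma>) x $ 2 * \<gamma> x $ 1)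
      - (D (D \<gamma>) x $ 1 * \<gamma> x $ 2 + D \<gamma> x $ 2 * D \<gamma> x $ 1)) (at x)"
      unfolding det .
    have "D (D \<gamma>) x $ 2 * \<gamma> x $ 1 = D (D \<gamma>) x $ 1 * \<gamma> x $ 2"
      using DERIV_unique[OF e DERIV_const] by (simp add: mult.commute)
    moreover have "\<gamma> x $ 1 * D \<gamma> x $ 2 - D \<gamma> x $ 1 * \<gamma> x $ 2 = 1"
      using det[of x] unfolding det_mat_of_cols .
    ultimately have "D (D \<gamma>) x $ 1 = ?\<kappa> x * \<gamma> x $ 1" "D (D \<gamma>) x $ 2 = ?\<kappa> x * \<gamma> x $ 2"
      unfolding det_mat_of_cols by algebra+
    then show ?thesis by (simp add: vec_eq_iff forall_2)
  qed
  show k: "central_affine_curvature \<gamma> = ?\<kappa>"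
    by (rule central_affine_curvature_eqI[OF n0 smooth_det_mat_of_cols[OF s(3,2)] eq])
  show "D (D \<gamma>) x = central_affine_curvature \<gamma> x *\<^sub>R \<gamma> x" unfolding k by (rule eq)
qed

section \<open>The linear system of a KdV solution\<close>

definition frame_A :: "(real \<times> real \<Rightarrow> real) \<Rightarrow> real \<times> real \<Rightarrow> real ^ 2 ^ 2" where
  "frame_A q z = mat_of_entries 0 (q z) 1 0"

definition frame_B :: "(real \<times> real \<Rightarrow> real) \<Rightarrow> real \<times> real \<Rightarrow> real ^ 2 ^ 2" where
  "frame_B q z = mat_of_entries
        (1/4 * Dx q z) (1/4 * (Dx (Dx q) z - 2 * (q z)\<^sup>2))
        (- (q z / 2)) (- (1/4 * Dx q z))"

lemma smooth_frame_A: "smooth q \<Longrightarrow> smooth (frame_A q)"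
  unfolding frame_A_def by (intro smooth_mat_of_entries smooth_const)

lemma smooth_frame_B:
  assumes "smooth q" shows "smooth (frame_B q)"
proof -
  have "frame_B q = (\<lambda>z. mat_of_entries (1/4 * Dx q z) (1/4 * (Dx (Dx q) z - 2 * (q z * q z)))
      (- (1/2 * q z)) (- (1/4 * Dx q z)))"
    by (simp add: frame_B_def power2_eq_square fun_eq_iff)
  then show ?thesis
    using assms by (simp only:) (intro smooth_mat_of_entries smooth_minus smooth_mult smooth_diff smooth_const smooth_Dx)
qed

text \<open>
  Three of the four matrix entries are identities; the upper right one is the KdV equation.
\<close>

lemma kdv_zero_curvature:
  assumes "kdv_solution q"
  shows "Dt (frame_A q) z + frame_B q z ** frame_A q z = Dx (frame_B q) z + frame_A q z ** frame_B q z"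
proof -
  obtain x t where z: "z = (x, t)" by (cases z)
  have s: "smooth q" "smooth (Dx q)" "smooth (Dx (Dx q))" using assms by (auto simp: kdv_solution_def intro!: smooth_Dx)
  have A: "Dt (frame_A q) (x, t) = mat_of_entries 0 (Dt q (x, t)) 0 0"
    unfolding frame_A_def
    by (intro Dt_eqI mat_of_entries_has_vector_derivative has_vector_derivative_const smooth_Dt_has s)
  note d = smooth_Dx_has_real[OF s(1), of t x] smooth_Dx_has_real[OF s(2), of t x] smooth_Dx_has_real[OF s(3), of t x]
  have B: "Dx (frame_B q) (x, t) = mat_of_entries
        (1/4 * Dx (Dx q) (x, t)) (1/4 * (Dx (Dx (Dx q)) (x, t) - 4 * q (x, t) * Dx q (x, t)))
        (- (Dx q (x, t) / 2)) (- (1/4 * Dx (Dx q) (x, t)))"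
    unfolding frame_B_def
    by (intro Dx_eqI mat_of_entries_has_vector_derivative;
        unfold has_real_derivative_iff_has_vector_derivative[symmetric];
        auto intro!: derivative_eq_intros d)
  have "Dt q (x, t) = 1/4 * (Dx (Dx (Dx q)) (x, t) - 6 * q (x, t) * Dx q (x, t))"
    using assms unfolding kdv_solution_def by blast
  then show ?thesis
    unfolding z A B unfolding frame_A_def frame_B_def mat_of_entries_mult mat_of_entries_add
    by (simp add: vec_eq_iff forall_2 field_simps power2_eq_square)
qed

lemma frame_solution_iff:
  "frame_solution q \<gamma>\<^sub>0 g \<longleftrightarrow> smooth g \<and> (\<forall>z. det (g z) = 1) \<and>
     (\<forall>z. Dx g z = g z ** frame_A q z) \<and> (\<forall>z. Dt g z = g z ** frame_B q z) \<and>
     g (0, 0) = mat_of_cols (\<gamma>\<^sub>0 0) (D \<gamma>\<^sub>0 0)"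
  by (simp add: frame_solution_def frame_A_def frame_B_def)

lemma frame_solution_unique:
  assumes "smooth q" "frame_solution q \<gamma>\<^sub>0 g" "frame_solution q \<gamma>\<^sub>0 h"
  shows "g = h"
  using assms(2,3) unfolding frame_solution_iff
  by (intro parallel_section_unique[OF bounded_bilinear_matrix_mult smooth_frame_A[OF assms(1)]
        smooth_frame_B[OF assms(1)]]) (simp_all del: split_paired_All)

lemma frame_solution_exists:
  assumes q: "kdv_solution q" and \<gamma>\<^sub>0: "\<gamma>\<^sub>0 \<in> M2"
  obtains g where "frame_solution q \<gamma>\<^sub>0 g"
proof -
  have s: "smooth q" using q by (simp add: kdv_solution_def)
  have flat: "v ** Dt (frame_A q) z + v ** frame_B q z ** frame_A q z =
      v ** Dx (frame_B q) z + v ** frame_A q z ** frame_B q z" for v z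
    unfolding matrix_mul_assoc[symmetric] matrix_add_ldistrib[symmetric] kdv_zero_curvature[OF q] ..
  obtain g where g: "smooth g" "g (0, 0) = mat_of_cols (\<gamma>\<^sub>0 0) (D \<gamma>\<^sub>0 0)"
    "\<And>z. Dx g z = g z ** frame_A q z" "\<And>z. Dt g z = g z ** frame_B q z"
    using flat_connection_parallel_section[OF bounded_bilinear_matrix_mult smooth_frame_A[OF s]
        smooth_frame_B[OF s] flat] by blast
  have "det (g (x, t)) = 1" for x t
  proof -
    have "det (g (x, t)) = det (g (0, t))"
      using smooth_Dx_has[OF g(1)] unfolding g(3)
      by (rule det_constant[of "\<lambda>x. g (x, t)" "\<lambda>x. frame_A q (x, t)"]) (simp add: frame_A_def)
    also have "\<dots> = det (g (0, 0))"
      using smooth_Dt_has[OF g(1)] unfolding g(4)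
      by (rule det_constant[of "\<lambda>t. g (0, t)" "\<lambda>t. frame_B q (0, t)"]) (simp add: frame_B_def)
    also have "\<dots> = 1" using \<gamma>\<^sub>0 unfolding g(2) M2_def by simp
    finally show ?thesis .
  qed
  with g have "frame_solution q \<gamma>\<^sub>0 g" unfolding frame_solution_iff by (simp add: split_paired_all)
  then show thesis by (rule that)
qed

lemma Dx_linear:
  assumes "bounded_linear L" "smooth f"
  shows "Dx (\<lambda>z. L (f z)) = (\<lambda>z. L (Dx f z))"
proof (intro ext, clarify)
  fix x t
  show "Dx (\<lambda>z. L (f z)) (x, t) = L (Dx f (x, t))"
    by (rule Dx_eqI[OF bounded_linear.has_vector_derivative[OF assms(1) smooth_Dx_has[OF assms(2)]]])
qed

lemma Dt_linear:
  assumes "bounded_linear L" "smooth f"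
  shows "Dt (\<lambda>z. L (f z)) = (\<lambda>z. L (Dt f z))"
proof (intro ext, clarify)
  fix x t
  show "Dt (\<lambda>z. L (f z)) (x, t) = L (Dt f (x, t))"
    by (rule Dt_eqI[OF bounded_linear.has_vector_derivative[OF assms(1) smooth_Dt_has[OF assms(2)]]])
qed

text \<open>
  The second column of a frame is the \<open>x\<close>-derivative of the first one, since \<open>A\<close> maps \<open>(1, 0)\<close> to
  \<open>(0, 1)\<close>; everything else is read off from the columns of \<open>A\<close> and \<open>B\<close>.
\<close>

lemma frame_first_column:
  assumes q: "smooth q" and g: "frame_solution q \<gamma>\<^sub>0 g"
  defines "\<gamma> \<equiv> \<lambda>z. g z *v vector [1, 0]"
  shows "smooth \<gamma>" "(\<lambda>x. \<gamma> (x, t)) \<in> M2" "flow_curvature \<gamma> = q"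
    "Dt \<gamma> z = (1/4 * Dx q z) *\<^sub>R \<gamma> z - (1/2 * q z) *\<^sub>R Dx \<gamma> z"
proof -
  let ?e1 = "vector [1, 0] :: real ^ 2" and ?e2 = "vector [0, 1] :: real ^ 2"
  note L = bounded_linear_matrix_vector_left
  have gs: "smooth g" and gd: "\<And>z. det (g z) = 1" and gx: "\<And>z. Dx g z = g z ** frame_A q z"
    and gt: "\<And>z. Dt g z = g z ** frame_B q z"
    using g unfolding frame_solution_iff by auto
  show s: "smooth \<gamma>" unfolding \<gamma>_def by (rule smooth_linear[OF L gs])
  have comb: "M *v vector [a, b] = a *\<^sub>R (M *v ?e1) + b *\<^sub>R (M *v ?e2)" for M :: "real ^ 2 ^ 2" and a b
    by (simp add: vec_eq_iff forall_2 matrix_vector_mult_def sum_2 mult.commute)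
  have ent: "mat_of_entries a b c d *v ?e1 = vector [a, c]" "mat_of_entries a b c d *v ?e2 = vector [b, d]" for a b c d
    by (simp_all add: vec_eq_iff forall_2 matrix_vector_mult_def sum_2)
  have dx: "Dx \<gamma> = (\<lambda>z. g z *v ?e2)"
    unfolding \<gamma>_def Dx_linear[OF L gs] gx
    by (simp add: frame_A_def ent flip: matrix_vector_mul_assoc)
  have dxx: "Dx (Dx \<gamma>) = (\<lambda>z. q z *\<^sub>R \<gamma> z)"
  proof -
    have "Dx (Dx \<gamma>) z = g z *v vector [q z, 0]" for z
      unfolding dx Dx_linear[OF L gs] gx
      by (simp add: frame_A_def ent flip: matrix_vector_mul_assoc)
    then show ?thesis unfolding comb[of _ "q _"] \<gamma>_def by auto
  qed
  have t: "Dt \<gamma> z = g z *v vector [1/4 * Dx q z, - (1/2 * q z)]"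
    unfolding \<gamma>_def Dt_linear[OF L gs] gt
    by (simp add: frame_B_def ent flip: matrix_vector_mul_assoc)
  show "Dt \<gamma> z = (1/4 * Dx q z) *\<^sub>R \<gamma> z - (1/2 * q z) *\<^sub>R Dx \<gamma> z"
    unfolding t dx comb[of "g z" "1/4 * Dx q z"] by (simp add: \<gamma>_def)
  have D1: "D (\<lambda>x. \<gamma> (x, t)) = (\<lambda>x. Dx \<gamma> (x, t))" for t by (simp add: Dx_def)
  have D2: "D (\<lambda>x. Dx \<gamma> (x, t)) = (\<lambda>x. Dx (Dx \<gamma>) (x, t))" for t by (simp add: Dx_def)
  have "mat_of_cols (\<gamma> z) (Dx \<gamma> z) = g z" for z
    unfolding dx unfolding \<gamma>_def by (simp add: vec_eq_iff forall_2 matrix_vector_mult_def sum_2)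
  then have det: "det (mat_of_cols (\<gamma> z) (Dx \<gamma> z)) = 1" for z by (simp add: gd)
  have n0: "\<gamma> z \<noteq> 0" for z using det[of z] by (auto simp: det_mat_of_cols)
  show "(\<lambda>x. \<gamma> (x, t)) \<in> M2"
    unfolding M2_def using smooth_slice_x[OF s] n0 det by (simp add: D1)
  show "flow_curvature \<gamma> = q"
  proof (intro ext, clarify)
    fix x t
    have "central_affine_curvature (\<lambda>y. \<gamma> (y, t)) = (\<lambda>y. q (y, t))"
      by (rule central_affine_curvature_eqI[OF n0 smooth_slice_x[OF q]]) (simp add: D1 D2 dxx)
    then show "flow_curvature \<gamma> (x, t) = q (x, t)" by (simp add: flow_curvature_def)
  qed
qed

section \<open>The frame of a curve flow solution\<close>

text \<open>
  The equation \<open>\<beta>\<^sub>x\<^sub>x = p \<beta>\<close> keeps \<open>x\<close>-derivatives in the span of \<open>\<beta>\<close> and \<open>\<beta>\<^sub>x\<close>, so the repeated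
  derivatives of \<open>\<beta>\<^sub>t\<close> can be computed on coordinates alone.
\<close>

lemma moving_frame_Dx:
  fixes \<beta> :: "real \<times> real \<Rightarrow> real ^ 2"
  assumes s: "smooth a" "smooth b" "smooth \<beta>" and xx: "\<And>z. Dx (Dx \<beta>) z = p z *\<^sub>R \<beta> z"
  shows "Dx (\<lambda>z. a z *\<^sub>R \<beta> z + b z *\<^sub>R Dx \<beta> z) =
    (\<lambda>z. (Dx a z + b z * p z) *\<^sub>R \<beta> z + (a z + Dx b z) *\<^sub>R Dx \<beta> z)"
proof (intro ext, clarify)
  fix x t
  have "((\<lambda>y. a (y, t) *\<^sub>R \<beta> (y, t) + b (y, t) *\<^sub>R Dx \<beta> (y, t)) has_vector_derivative
      (a (x, t) *\<^sub>R Dx \<beta> (x, t) + Dx a (x, t) *\<^sub>R \<beta> (x, t))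
      + (b (x, t) *\<^sub>R Dx (Dx \<beta>) (x, t) + Dx b (x, t) *\<^sub>R Dx \<beta> (x, t))) (at x)"
    by (intro has_vector_derivative_add bounded_bilinear.has_vector_derivative[OF bounded_bilinear_scaleR]
        smooth_Dx_has smooth_Dx s)
  from Dx_eqI[OF this]
  show "Dx (\<lambda>z. a z *\<^sub>R \<beta> z + b z *\<^sub>R Dx \<beta> z) (x, t) =
    (Dx a (x, t) + b (x, t) * p (x, t)) *\<^sub>R \<beta> (x, t) + (a (x, t) + Dx b (x, t)) *\<^sub>R Dx \<beta> (x, t)"
    by (simp add: xx algebra_simps)
qed

text \<open>
  Differentiating \<open>\<beta>\<^sub>t = p\<^sub>x/4 \<beta> - p/2 \<beta>\<^sub>x\<close> once in \<open>x\<close> gives the second column of \<open>h\<^sub>t = h B\<close>.  A second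
  \<open>x\<close>-derivative, compared with \<open>(\<beta>\<^sub>x\<^sub>x)\<^sub>t = (p \<beta>)\<^sub>t\<close>, gives the KdV equation as the coefficient of
  \<open>\<beta>\<close>.
\<close>

lemma curve_flow_frame:
  assumes \<beta>: "curve_flow_solution \<beta>"
  defines "p \<equiv> flow_curvature \<beta>" and "h \<equiv> \<lambda>z. mat_of_cols (\<beta> z) (Dx \<beta> z)"
  shows "kdv_solution p" and "smooth h" and "det (h z) = 1"
    and "Dx h z = h z ** frame_A p z" and "Dt h z = h z ** frame_B p z"
proof -
  have s: "smooth \<beta>" and M2: "\<And>t. (\<lambda>x. \<beta> (x, t)) \<in> M2"
    and flow: "\<And>z. Dt \<beta> z = (1/4 * Dx p z) *\<^sub>R \<beta> z - (1/2 * p z) *\<^sub>R Dx \<beta> z"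
    using \<beta> unfolding curve_flow_solution_def p_def by (auto simp: Let_def)
  have sx: "smooth (Dx \<beta>)" "smooth (Dx (Dx \<beta>))" using s smooth_Dx by blast+
  have D1: "D (\<lambda>x. \<beta> (x, t)) = (\<lambda>x. Dx \<beta> (x, t))" for t by (simp add: Dx_def)
  have D2: "D (\<lambda>x. Dx \<beta> (x, t)) = (\<lambda>x. Dx (Dx \<beta>) (x, t))" for t by (simp add: Dx_def)
  have pk: "p (x, t) = central_affine_curvature (\<lambda>x. \<beta> (x, t)) x" for x t
    by (simp add: p_def flow_curvature_def)
  have "p (x, t) = det (mat_of_cols (Dx (Dx \<beta>) (x, t)) (Dx \<beta> (x, t)))" for x t
    unfolding pk M2_curvature(1)[OF M2] D1 D2 ..
  then have "p = (\<lambda>z. det (mat_of_cols (Dx (Dx \<beta>) z) (Dx \<beta> z)))" by auto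
  then have p: "smooth p" using smooth_det_mat_of_cols[OF sx(2,1)] by simp
  have px: "smooth (Dx p)" "smooth (Dx (Dx p))" using p smooth_Dx by blast+
  have "Dx (Dx \<beta>) (x, t) = p (x, t) *\<^sub>R \<beta> (x, t)" for x t
    using M2_curvature(2)[OF M2, of t x] unfolding D1 D2 pk .
  then have xx: "Dx (Dx \<beta>) z = p z *\<^sub>R \<beta> z" for z by (cases z) simp
  have n0: "\<beta> z \<noteq> 0" for z using M2[of "snd z"] unfolding M2_def by (cases z) auto
  show "smooth h" unfolding h_def by (rule smooth_mat_of_cols[OF s sx(1)])
  show "det (h z) = 1" using M2[of "snd z"] unfolding M2_def h_def by (cases z) (auto simp: D1)
  have "Dx h (x, t) = mat_of_cols (Dx \<beta> (x, t)) (Dx (Dx \<beta>) (x, t))" for x t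
    unfolding h_def by (intro Dx_eqI mat_of_cols_has_vector_derivative smooth_Dx_has s sx)
  then have "Dx h z = mat_of_cols (Dx \<beta> z) (Dx (Dx \<beta>) z)" for z by (cases z) simp
  then show "Dx h z = h z ** frame_A p z"
    unfolding frame_A_def xx by (simp add: h_def mat_of_cols_mult)
  have t: "Dt \<beta> = (\<lambda>z. (1/4 * Dx p z) *\<^sub>R \<beta> z + (- (1/2 * p z)) *\<^sub>R Dx \<beta> z)"
    using flow by (simp add: fun_eq_iff)
  have sc: "smooth (\<lambda>z. 1/4 * Dx p z)" "smooth (\<lambda>z. - (1/2 * p z))"
    by (intro smooth_minus smooth_mult smooth_const p px)+
  have "Dx (\<lambda>z. c * f z) = (\<lambda>z. c * Dx f z)" if "smooth f" for c :: real and f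
    by (rule Dx_linear[OF bounded_linear_mult_right that])
  note cm = this
  have c: "Dx (\<lambda>z. 1/4 * Dx p z) = (\<lambda>z. 1/4 * Dx (Dx p) z)" "Dx (\<lambda>z. - (1/2 * p z)) = (\<lambda>z. - (1/2 * Dx p z))"
    using cm[OF px(1), of "1/4"] cm[OF p, of "-(1/2)"] by (simp_all only: mult_minus_left)
  have tx: "Dx (Dt \<beta>) = (\<lambda>z. (1/4 * Dx (Dx p) z - 1/2 * (p z * p z)) *\<^sub>R \<beta> z + (- (1/4 * Dx p z)) *\<^sub>R Dx \<beta> z)"
    unfolding t moving_frame_Dx[OF sc s xx] c by (simp add: fun_eq_iff algebra_simps)
  have sc': "smooth (\<lambda>z. 1/4 * Dx (Dx p) z - 1/2 * (p z * p z))" "smooth (\<lambda>z. - (1/4 * Dx p z))"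
    by (intro smooth_minus smooth_diff smooth_mult smooth_const p px)+
  have c': "Dx (\<lambda>z. 1/4 * Dx (Dx p) z - 1/2 * (p z * p z)) (x, t) = 1/4 * Dx (Dx (Dx p)) (x, t) - p (x, t) * Dx p (x, t)"
    "Dx (\<lambda>z. - (1/4 * Dx p z)) (x, t) = - (1/4 * Dx (Dx p) (x, t))" for x t
    unfolding atomize_conj
    using smooth_Dx_has_real[OF p, of t x] smooth_Dx_has_real[OF px(1), of t x] smooth_Dx_has_real[OF px(2), of t x]
    by (intro conjI Dx_eqI; unfold has_real_derivative_iff_has_vector_derivative[symmetric];
        auto intro!: derivative_eq_intros)
  have txx: "Dx (Dx (Dt \<beta>)) (x, t) =
      (1/4 * Dx (Dx (Dx p)) (x, t) - 5/4 * (p (x, t) * Dx p (x, t))) *\<^sub>R \<beta> (x, t)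
      - (1/2 * (p (x, t) * p (x, t))) *\<^sub>R Dx \<beta> (x, t)" for x t
    unfolding tx moving_frame_Dx[OF sc' s xx] c' by (simp add: algebra_simps)
  have comm: "Dt (Dx \<beta>) = Dx (Dt \<beta>)" "Dt (Dx (Dx \<beta>)) = Dx (Dx (Dt \<beta>))"
    using mixed_partials_commute[OF s] mixed_partials_commute[OF sx(1)] by simp_all
  have "Dt h (x, t) = mat_of_cols (Dt \<beta> (x, t)) (Dt (Dx \<beta>) (x, t))" for x t
    unfolding h_def by (intro Dt_eqI mat_of_cols_has_vector_derivative smooth_Dt_has s sx)
  then have "Dt h z = mat_of_cols (Dt \<beta> z) (Dt (Dx \<beta>) z)" for z by (cases z) simp
  then show "Dt h z = h z ** frame_B p z"
    unfolding frame_B_def comm tx unfolding t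
    by (simp add: h_def mat_of_cols_mult power2_eq_square algebra_simps)
  have kdv: "Dt p (x, t) = 1/4 * (Dx (Dx (Dx p)) (x, t) - 6 * p (x, t) * Dx p (x, t))" for x t
  proof -
    have "Dx (Dx \<beta>) = (\<lambda>z. p z *\<^sub>R \<beta> z)" using xx by auto
    moreover have "Dt (\<lambda>z. p z *\<^sub>R \<beta> z) (x, t) = p (x, t) *\<^sub>R Dt \<beta> (x, t) + Dt p (x, t) *\<^sub>R \<beta> (x, t)"
      by (intro Dt_eqI bounded_bilinear.has_vector_derivative[OF bounded_bilinear_scaleR] smooth_Dt_has s p)
    ultimately have "Dx (Dx (Dt \<beta>)) (x, t) = p (x, t) *\<^sub>R Dt \<beta> (x, t) + Dt p (x, t) *\<^sub>R \<beta> (x, t)"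
      unfolding comm(2)[symmetric] by simp
    then have "(Dt p (x, t) - 1/4 * (Dx (Dx (Dx p)) (x, t) - 6 * p (x, t) * Dx p (x, t))) *\<^sub>R \<beta> (x, t) = 0"
      unfolding txx unfolding t by (auto simp: algebra_simps simp flip: scaleR_add_left)
    with n0 show ?thesis by simp
  qed
  show "kdv_solution p" unfolding kdv_solution_def using p kdv by auto
qed

section \<open>The Cauchy problem for the curve flow\<close>

lemma Dx_funpow_slice: "(Dx ^^ n) q (x, t) = (D ^^ n) (\<lambda>y. q (y, t)) x"
proof (induction n arbitrary: x)
  case (Suc n)
  then have "(\<lambda>y. (Dx ^^ n) q (y, t)) = (D ^^ n) (\<lambda>y. q (y, t))" by auto
  then show ?case by (simp add: Dx_def[of "(Dx ^^ n) q"])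
qed simp

lemma rapidly_decaying_slice_schwartz:
  assumes "smooth q" "rapidly_decaying_loc_unif q"
  shows "schwartz (\<lambda>x. q (x, t))"
  unfolding schwartz_def
proof (intro conjI allI)
  show "smooth (\<lambda>x. q (x, t))" by (rule smooth_slice_x[OF assms(1)])
  fix m n
  have "compact {t}" by simp
  from assms(2)[unfolded rapidly_decaying_loc_unif_def, rule_format, OF this, of m n]
  show "\<exists>C. \<forall>x. \<bar>x ^ m * (D ^^ n) (\<lambda>x. q (x, t)) x\<bar> \<le> C"
    by (simp add: Dx_funpow_slice)
qed

theorem theorem2p9:
  fixes \<gamma>\<^sub>0 :: "real \<Rightarrow> real ^ 2" and q :: "real \<times> real \<Rightarrow> real"
  assumes "\<gamma>\<^sub>0 \<in> M2"
    and "schwartz (central_affine_curvature \<gamma>\<^sub>0)"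
    and "kdv_solution q"
    and "rapidly_decaying_loc_unif q"
    and "\<forall>x. q (x, 0) = central_affine_curvature \<gamma>\<^sub>0 x"
  shows "(\<exists>!g. frame_solution q \<gamma>\<^sub>0 g) \<and>
    (\<forall>g \<gamma>. frame_solution q \<gamma>\<^sub>0 g \<and> \<gamma> = (\<lambda>z. g z *v vector [1, 0]) \<longrightarrow>
       curve_flow_cauchy \<gamma>\<^sub>0 \<gamma> \<and>
       (\<forall>\<beta>. curve_flow_cauchy \<gamma>\<^sub>0 \<beta> \<longrightarrow> \<beta> = \<gamma>) \<and>
       flow_curvature \<gamma> = q \<and>
       (\<forall>t. schwartz (central_affine_curvature (\<lambda>x. \<gamma> (x, t)))))"
proof -
  have q: "smooth q" using assms(3) by (simp add: kdv_solution_def)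
  have \<gamma>\<^sub>0: "smooth \<gamma>\<^sub>0" "smooth (D \<gamma>\<^sub>0)" using assms(1) by (auto simp: M2_def intro: smooth_D)
  have col1: "mat_of_cols u v *v vector [1, 0] = u" for u v
    by (simp add: vec_eq_iff forall_2 matrix_vector_mult_def sum_2)
  have initial: "g (x, 0) = mat_of_cols (\<gamma>\<^sub>0 x) (D \<gamma>\<^sub>0 x)" if g: "frame_solution q \<gamma>\<^sub>0 g" for g x
  proof (rule linear_ode_unique[OF bounded_bilinear_matrix_mult, where A="\<lambda>x. frame_A q (x, 0)"
        and y="\<lambda>x. g (x, 0)" and z="\<lambda>x. mat_of_cols (\<gamma>\<^sub>0 x) (D \<gamma>\<^sub>0 x)"])
    have gs: "smooth g" and gx: "\<And>z. Dx g z = g z ** frame_A q z"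
      and g0: "g (0, 0) = mat_of_cols (\<gamma>\<^sub>0 0) (D \<gamma>\<^sub>0 0)"
      using g unfolding frame_solution_iff by auto
    show "continuous_on UNIV (\<lambda>x. frame_A q (x, 0))"
      by (rule smooth_continuous[OF smooth_slice_x[OF smooth_frame_A[OF q]]])
    show "((\<lambda>x. g (x, 0)) has_vector_derivative g (x, 0) ** frame_A q (x, 0)) (at x)" for x
      using smooth_Dx_has[OF gs, of 0 x] unfolding gx .
    show "g (0, 0) = mat_of_cols (\<gamma>\<^sub>0 0) (D \<gamma>\<^sub>0 0)" by (rule g0)
    fix x
    have "mat_of_cols (\<gamma>\<^sub>0 x) (D \<gamma>\<^sub>0 x) ** frame_A q (x, 0) = mat_of_cols (D \<gamma>\<^sub>0 x) (D (D \<gamma>\<^sub>0) x)"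
      unfolding M2_curvature(2)[OF assms(1)] using assms(5) by (simp add: frame_A_def mat_of_cols_mult)
    then show "((\<lambda>x. mat_of_cols (\<gamma>\<^sub>0 x) (D \<gamma>\<^sub>0 x)) has_vector_derivative
        mat_of_cols (\<gamma>\<^sub>0 x) (D \<gamma>\<^sub>0 x) ** frame_A q (x, 0)) (at x)"
      using mat_of_cols_has_vector_derivative[OF \<gamma>\<^sub>0[THEN smooth_D(1)], of x] by simp
  qed
  have flow: "curve_flow_cauchy \<gamma>\<^sub>0 (\<lambda>z. g z *v vector [1, 0])"
    if g: "frame_solution q \<gamma>\<^sub>0 g" for g
    using frame_first_column[OF q g] assms(4) initial[OF g] col1
    unfolding curve_flow_cauchy_def curve_flow_solution_def by (simp add: Let_def)
  have unique: "\<beta> = (\<lambda>z. g z *v vector [1, 0])"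
    if g: "frame_solution q \<gamma>\<^sub>0 g" and b: "curve_flow_cauchy \<gamma>\<^sub>0 \<beta>" for g \<beta>
  proof -
    have sol: "curve_flow_solution \<beta>" and dec: "rapidly_decaying_loc_unif (flow_curvature \<beta>)"
      and b0: "(\<lambda>x. \<beta> (x, 0)) = \<gamma>\<^sub>0"
      using b unfolding curve_flow_cauchy_def by auto
    have p: "flow_curvature \<beta> = q"
    proof (rule kdv_unique[OF curve_flow_frame(1)[OF sol] dec assms(3,4)])
      show "flow_curvature \<beta> (x, 0) = q (x, 0)" for x
        using assms(5) by (simp add: flow_curvature_def b0)
    qed
    define h where "h = (\<lambda>z. mat_of_cols (\<beta> z) (Dx \<beta> z))"
    have "Dx \<beta> (0, 0) = D \<gamma>\<^sub>0 0" unfolding Dx_def using b0 by simp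
    moreover have "\<beta> (0, 0) = \<gamma>\<^sub>0 0" using b0 by (rule fun_cong)
    ultimately have "frame_solution q \<gamma>\<^sub>0 h"
      using curve_flow_frame(2-)[OF sol] unfolding frame_solution_iff h_def p by simp
    from frame_solution_unique[OF q g this] show ?thesis by (simp add: h_def col1)
  qed
  have schwartz: "schwartz (central_affine_curvature (\<lambda>x. \<gamma> (x, t)))"
    if "flow_curvature \<gamma> = q" for \<gamma> t
  proof -
    have "central_affine_curvature (\<lambda>x. \<gamma> (x, t)) x = q (x, t)" for x
      using fun_cong[OF that, of "(x, t)"] by (simp add: flow_curvature_def)
    then have "central_affine_curvature (\<lambda>x. \<gamma> (x, t)) = (\<lambda>x. q (x, t))" by (rule ext)
    with rapidly_decaying_slice_schwartz[OF q assms(4)] show ?thesis by simp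
  qed
  obtain g where g: "frame_solution q \<gamma>\<^sub>0 g"
    by (rule frame_solution_exists[OF assms(3,1)])
  have "\<exists>!g. frame_solution q \<gamma>\<^sub>0 g"
    by (rule ex1I[where a=g]) (rule g, rule frame_solution_unique[OF q _ g])
  moreover have "curve_flow_cauchy \<gamma>\<^sub>0 \<gamma> \<and>
       (\<forall>\<beta>. curve_flow_cauchy \<gamma>\<^sub>0 \<beta> \<longrightarrow> \<beta> = \<gamma>) \<and>
       flow_curvature \<gamma> = q \<and>
       (\<forall>t. schwartz (central_affine_curvature (\<lambda>x. \<gamma> (x, t))))"
    if "frame_solution q \<gamma>\<^sub>0 g \<and> \<gamma> = (\<lambda>z. g z *v vector [1, 0])" for g \<gamma>
  proof -
    have g: "frame_solution q \<gamma>\<^sub>0 g" and \<gamma>: "\<gamma> = (\<lambda>z. g z *v vector [1, 0])" using that by auto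
    have k: "flow_curvature \<gamma> = q" unfolding \<gamma> by (rule frame_first_column(3)[OF q g])
    show ?thesis
      using flow[OF g] unique[OF g] k schwartz[OF k] unfolding \<gamma> by blast
  qed
  ultimately show ?thesis by blast
qed

end
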